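(* Let $\Omega\subseteq\mathbb{P}(\mathbb{R}^d)$ be a quasi-homogeneous properly convex domain and $1\le m\le d-1$. Then the following are equivalent: (1) $\mathrm{r}_{\rm PES}(\Omega)\le m$; (2) there exists a positive constant $\delta=\delta(\Omega)$ such that every compact $k$-simplex in $\Omega$ with $k\ge m+1$ is $\delta$-slim.
   Context: A properly convex domain is a nonempty open set $\Omega\subset\mathbb{P}(\mathbb{R}^d)$ whose closure $\overline{\Omega}$ lies in some affine chart, in which $\Omega$ is a bounded convex set; its dimension is assumed to be at least one. $\partial\Omega=\overline\Omega\setminus\Omega$, $\mathrm{Aut}(\Omega)=\{g\in \mathrm{PGL}_d(\mathbb{R}): g\Omega=\Omega\}$, and $\Omega$ is quasi-homogeneous if there is a compact $K\subset\Omega$ with $\mathrm{Aut}(\Omega)\cdot K=\Omega$. Hilbert metric: for distinct $x,y\in\Omega$ let $x_\infty,y_\infty\in\partial\Omega$ be the endpoints of the intersection of the projective line through $x,y$ with $\overline\Omega$, ordered $x_\infty,x,y,y_\infty$; then $d_\Omega(x,y)=\frac12\log\frac{|y-x_\infty||x-y_\infty|}{|x-x_\infty||y-y_\infty|}$ (and $d_\Omega(x,x)=0$). For nonempty $C\subset\Omega$ and $\delta>0$, $\mathcal{N}_\delta(C)=\{x\in\Omega: d_\Omega(x,C)<\delta\}$. $\mathrm{CH}_\Omega(X)$ is the convex hull of $X$ in $\overline\Omega$, i.e. the intersection of all convex subsets of $\overline\Omega$ (convex in the affine chart) containing $X$. For $k\ge1$, a $k$-simplex is $S=\mathrm{CH}_\Omega(v_0,\dots,v_k)$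 with an ordered tuple of vertices $v_0,\dots,v_k\in\overline\Omega$ (no general position is required); it is non-degenerate if $\dim\mathbb{P}(\mathrm{Span}\{v_0,\dots,v_k\})=k$. Its facets are $F^i(S)=\mathrm{CH}_\Omega(v_0,\dots,\widehat{v_i},\dots,v_k)$. It is a compact $k$-simplex in $\Omega$ if all $v_i\in\Omega$. A compact $k$-simplex $S$ is $\delta$-slim if for all $0\le i\le k$, $F^i(S)\subset\bigcup_{j\ne i}\mathcal{N}_\delta(F^j(S))$. A $k$-dimensional PES in $\Omega$, $k\ge1$, is a non-degenerate $k$-simplex $S$ with vertices in $\partial\Omega$ such that $S\cap\Omega\ne\emptyset$ and $F^i(S)\subset\partial\Omega$ for all $i$. The projective simplex rank is $\mathrm{r}_{\rm PES}(\Omega)=\sup\{\dim S: S\text{ is a PES in }\Omega\}$. *)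

theory Defs
  imports "HOL-Analysis.Analysis"
begin

typedef 'd rproj = "{L :: (real^'d::finite) set. subspace L \<and> dim L = 1}"
  morphisms line_of Abs_rproj
proof
  show "span {axis undefined 1 :: real^'d} \<in> {L. subspace L \<and> dim L = 1}"
    by (simp add: axis_eq_0_iff)
qed

text \<open>The class \<open>[v]\<close> of a vector; meaningful for \<open>v \<noteq> 0\<close> only.\<close>

definition pclass :: "real^'d::finite \<Rightarrow> 'd rproj" where
  "pclass v = Abs_rproj (span {v})"

lemma line_of_pclass: "v \<noteq> 0 \<Longrightarrow> line_of (pclass v) = span {v}"
  unfolding pclass_def by (rule Abs_rproj_inverse) simp

text \<open>The quotient topology from \<open>v \<mapsto> [v]\<close> on the nonzero vectors.\<close>

instantiation rproj :: (finite) topological_space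
begin

definition open_rproj :: "'a rproj set \<Rightarrow> bool" where
  "open_rproj U \<longleftrightarrow> open {v. v \<noteq> 0 \<and> pclass v \<in> U}"

instance
proof
  have "{v :: real^'a. v \<noteq> 0} = - {0}" by auto
  then show "open (UNIV :: 'a rproj set)"
    by (simp add: open_rproj_def open_Compl)
next
  fix S T :: "'a rproj set"
  assume "open S" "open T"
  moreover have "{v. v \<noteq> 0 \<and> pclass v \<in> S \<inter> T} =
      {v. v \<noteq> 0 \<and> pclass v \<in> S} \<inter> {v. v \<noteq> 0 \<and> pclass v \<in> T}" by auto
  ultimately show "open (S \<inter> T)"
    by (simp only: open_rproj_def open_Int)
next
  fix K :: "'a rproj set set"
  assume "\<forall>S\<in>K. open S"
  moreover have "{v. v \<noteq> 0 \<and> pclass v \<in> \<Union>K} = (\<Union>S\<in>K. {v. v \<noteq> 0 \<and> pclass v \<in> S})" by auto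
  ultimately show "open (\<Union>K)"
    by (simp only: open_rproj_def open_UN)
qed

end

text \<open>A nonzero vector \<open>a\<close> determines the affine chart of all lines not contained in the hyperplane
  \<open>{v. a \<bullet> v = 0}\<close>; it is identified with the affine space \<open>{v. a \<bullet> v = 1}\<close>.\<close>

definition affine_chart :: "real^'d::finite \<Rightarrow> 'd rproj set" where
  "affine_chart a = {p. \<exists>v\<in>line_of p. a \<bullet> v \<noteq> 0}"

definition chart_coord :: "real^'d::finite \<Rightarrow> 'd rproj \<Rightarrow> real^'d" where
  "chart_coord a p = (THE v. v \<in> line_of p \<and> a \<bullet> v = 1)"

definition adapted_chart :: "'d::finite rproj set \<Rightarrow> real^'d \<Rightarrow> bool" where
  "adapted_chart \<Omega> a \<longleftrightarrow> a \<noteq> 0 \<and> closure \<Omega> \<subseteq> affine_chart a \<and>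
     convex (chart_coord a ` \<Omega>) \<and> bounded (chart_coord a ` \<Omega>)"

text \<open>The domain \<open>\<Omega>\<close> is open in \<open>P(\<real>\<^sup>d)\<close>, so its dimension is \<open>d - 1\<close>.\<close>

definition properly_convex_domain :: "'d::finite rproj set \<Rightarrow> bool" where
  "properly_convex_domain \<Omega> \<longleftrightarrow>
     \<Omega> \<noteq> {} \<and> open \<Omega> \<and> (\<exists>a. adapted_chart \<Omega> a) \<and> CARD('d) - 1 \<ge> 1"

definition ideal_boundary :: "'d::finite rproj set \<Rightarrow> 'd rproj set" where
  "ideal_boundary \<Omega> = closure \<Omega> - \<Omega>"

text \<open>\<open>PGL\<^sub>d(\<real>)\<close> acts faithfully on \<open>P(\<real>\<^sup>d)\<close>, and is represented by its transformations.\<close>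

definition proj_map :: "real^'d^'d \<Rightarrow> 'd::finite rproj \<Rightarrow> 'd rproj" where
  "proj_map A p = Abs_rproj ((*v) A ` line_of p)"

definition PGL :: "('d::finite rproj \<Rightarrow> 'd rproj) set" where
  "PGL = {proj_map A | A. invertible A}"

definition Aut :: "'d::finite rproj set \<Rightarrow> ('d rproj \<Rightarrow> 'd rproj) set" where
  "Aut \<Omega> = {g \<in> PGL. g ` \<Omega> = \<Omega>}"

definition quasi_homogeneous :: "'d::finite rproj set \<Rightarrow> bool" where
  "quasi_homogeneous \<Omega> \<longleftrightarrow> (\<exists>K. compact K \<and> K \<subseteq> \<Omega> \<and> (\<Union>g\<in>Aut \<Omega>. g ` K) = \<Omega>)"

text \<open>The Hilbert metric and convexity in the closure of \<open>\<Omega>\<close> are computed in one chosen adapted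
  chart. Changing between two adapted charts is a projective transformation that is regular on the
  closure of \<open>\<Omega>\<close>, so it preserves segments, their order and cross-ratios: the
  choice does not matter.\<close>

definition coord :: "'d::finite rproj set \<Rightarrow> 'd rproj \<Rightarrow> real^'d" where
  "coord \<Omega> = chart_coord (SOME a. adapted_chart \<Omega> a)"

definition proj_line :: "'d::finite rproj \<Rightarrow> 'd rproj \<Rightarrow> 'd rproj set" where
  "proj_line x y = {z. line_of z \<subseteq> span (line_of x \<union> line_of y)}"

text \<open>\<open>p\<close> and \<open>q\<close> are the endpoints of the chord through \<open>x\<close> and \<open>y\<close>, in the order \<open>p, x, y, q\<close>.\<close>

definition chord_ends ::
    "'d::finite rproj set \<Rightarrow> 'd rproj \<Rightarrow> 'd rproj \<Rightarrow> 'd rproj \<Rightarrow> 'd rproj \<Rightarrow> bool" where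
  "chord_ends \<Omega> x y p q \<longleftrightarrow> p \<in> ideal_boundary \<Omega> \<and> q \<in> ideal_boundary \<Omega> \<and>
     coord \<Omega> ` (proj_line x y \<inter> closure \<Omega>) = closed_segment (coord \<Omega> p) (coord \<Omega> q) \<and>
     coord \<Omega> x \<in> open_segment (coord \<Omega> p) (coord \<Omega> y) \<and>
     coord \<Omega> y \<in> open_segment (coord \<Omega> x) (coord \<Omega> q)"

definition hilbert_dist :: "'d::finite rproj set \<Rightarrow> 'd rproj \<Rightarrow> 'd rproj \<Rightarrow> real" where
  "hilbert_dist \<Omega> x y =
     (if x = y then 0
      else let (p, q) = (THE (p, q). chord_ends \<Omega> x y p q); c = coord \<Omega> in
        1 / 2 * ln ((norm (c y - c p) * norm (c x - c q)) / (norm (c x - c p) * norm (c y - c q))))"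

definition hilbert_nbhd :: "'d::finite rproj set \<Rightarrow> real \<Rightarrow> 'd rproj set \<Rightarrow> 'd rproj set" where
  "hilbert_nbhd \<Omega> \<delta> C = {x \<in> \<Omega>. (INF c\<in>C. hilbert_dist \<Omega> x c) < \<delta>}"

definition CH :: "'d::finite rproj set \<Rightarrow> 'd rproj set \<Rightarrow> 'd rproj set" where
  "CH \<Omega> X = \<Inter>{C. C \<subseteq> closure \<Omega> \<and> convex (coord \<Omega> ` C) \<and> X \<subseteq> C}"

text \<open>The vertices of a \<open>k\<close>-simplex are \<open>v 0, \<dots>, v k\<close>; the values of \<open>v\<close> beyond \<open>k\<close> are irrelevant.\<close>

definition is_simplex :: "'d::finite rproj set \<Rightarrow> nat \<Rightarrow> (nat \<Rightarrow> 'd rproj) \<Rightarrow> bool" where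
  "is_simplex \<Omega> k v \<longleftrightarrow> k \<ge> 1 \<and> v ` {..k} \<subseteq> closure \<Omega>"

definition simplex_hull :: "'d::finite rproj set \<Rightarrow> nat \<Rightarrow> (nat \<Rightarrow> 'd rproj) \<Rightarrow> 'd rproj set" where
  "simplex_hull \<Omega> k v = CH \<Omega> (v ` {..k})"

text \<open>The vertex is removed by its index: with repeated vertices the facet may still contain it.\<close>

definition facet :: "'d::finite rproj set \<Rightarrow> nat \<Rightarrow> (nat \<Rightarrow> 'd rproj) \<Rightarrow> nat \<Rightarrow> 'd rproj set" where
  "facet \<Omega> k v i = CH \<Omega> (v ` ({..k} - {i}))"

text \<open>Here \<open>dim P(W) = dim W - 1\<close>.\<close>

definition nondegenerate :: "nat \<Rightarrow> (nat \<Rightarrow> 'd::finite rproj) \<Rightarrow> bool" where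
  "nondegenerate k v \<longleftrightarrow> dim (span (\<Union>i\<le>k. line_of (v i))) - 1 = k"

definition compact_simplex :: "'d::finite rproj set \<Rightarrow> nat \<Rightarrow> (nat \<Rightarrow> 'd rproj) \<Rightarrow> bool" where
  "compact_simplex \<Omega> k v \<longleftrightarrow> is_simplex \<Omega> k v \<and> v ` {..k} \<subseteq> \<Omega>"

definition slim :: "'d::finite rproj set \<Rightarrow> real \<Rightarrow> nat \<Rightarrow> (nat \<Rightarrow> 'd rproj) \<Rightarrow> bool" where
  "slim \<Omega> \<delta> k v \<longleftrightarrow>
     (\<forall>i\<le>k. facet \<Omega> k v i \<subseteq> (\<Union>j\<in>{..k} - {i}. hilbert_nbhd \<Omega> \<delta> (facet \<Omega> k v j)))"

definition PES :: "'d::finite rproj set \<Rightarrow> nat \<Rightarrow> (nat \<Rightarrow> 'd rproj) \<Rightarrow> bool" where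
  "PES \<Omega> k v \<longleftrightarrow> is_simplex \<Omega> k v \<and> nondegenerate k v \<and> v ` {..k} \<subseteq> ideal_boundary \<Omega> \<and>
     simplex_hull \<Omega> k v \<inter> \<Omega> \<noteq> {} \<and> (\<forall>i\<le>k. facet \<Omega> k v i \<subseteq> ideal_boundary \<Omega>)"

definition PES_rank :: "'d::finite rproj set \<Rightarrow> enat" where
  "PES_rank \<Omega> = Sup {enat k | k v. PES \<Omega> k v}"

end

theory Submission
  imports Defs
begin

text \<open>Lift \<open>\<Omega>\<close> to an open convex cone \<open>C\<close> in \<open>\<real>\<^sup>d\<close>. The Hilbert distance of \<open>[X]\<close> and \<open>[Y]\<close> is at most
  \<open>D\<close> iff \<open>\<alpha>Y - X\<close> and \<open>\<beta>X - Y\<close> lie in the closure of \<open>C\<close> for some \<open>\<alpha>, \<beta> > 0\<close> with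
  \<open>\<alpha>\<beta> \<le> exp (2D)\<close>, and simplices become finitely generated subcones.

  If slimness fails for every constant, the action of the automorphism group brings the witnessing
  points back to a compact set, and the simplices converge to a simplex with one facet meeting
  \<open>\<Omega>\<close> and all other facets in the boundary. Inside it, points moving from the good facet towards the
  opposite vertex go infinitely far from every facet, so a second limit yields a PES of the same
  dimension. A degenerate simplex is slim for free, since by a Radon type exchange each point of a
  facet lies on another facet; hence only finitely many dimensions matter for uniformity.

  Conversely, cut off a vertex of a PES by a hyperplane through an interior point \<open>Y\<close> and shrink
  the resulting simplex by a factor \<open>1 - \<epsilon>\<close> towards \<open>Y\<close>: the point \<open>Y\<close> of the cutting facet is at
  distance at least \<open>log (1/\<epsilon>) / 2\<close> from all other facets.\<close>

section \<open>Finitely generated cones\<close>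

text \<open>The generators form an indexed family and not a set, so that deleting an index matches
  the deletion of a vertex by its index even when vertices repeat.\<close>

definition conic_hull :: "('i \<Rightarrow> 'a::real_vector) \<Rightarrow> 'i set \<Rightarrow> 'a set" where
  "conic_hull V I = {\<Sum>l\<in>I. \<mu> l *\<^sub>R V l | \<mu>. \<forall>l\<in>I. 0 \<le> \<mu> l}"

lemma conic_hullI: "(\<And>l. l \<in> I \<Longrightarrow> 0 \<le> \<mu> l) \<Longrightarrow> (\<Sum>l\<in>I. \<mu> l *\<^sub>R V l) \<in> conic_hull V I"
  unfolding conic_hull_def by blast

lemma conic_hull_delete:
  assumes "finite I" "\<And>l. l \<in> I \<Longrightarrow> 0 \<le> \<mu> l" "\<mu> j = 0"
  shows "(\<Sum>l\<in>I. \<mu> l *\<^sub>R V l) \<in> conic_hull V (I - {j})"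
proof -
  have "(\<Sum>l\<in>I. \<mu> l *\<^sub>R V l) = (\<Sum>l\<in>I - {j}. \<mu> l *\<^sub>R V l)"
    by (rule sum.mono_neutral_right) (use assms in auto)
  then show ?thesis using assms(2) by (auto intro: conic_hullI)
qed

lemma conic_hull_deleteE:
  assumes "X \<in> conic_hull V (I - {j})" "finite I"
  obtains \<mu> where "X = (\<Sum>l\<in>I. \<mu> l *\<^sub>R V l)" "\<And>l. l \<in> I \<Longrightarrow> 0 \<le> \<mu> l" "\<mu> j = 0"
proof -
  obtain \<mu> where \<mu>: "X = (\<Sum>l\<in>I - {j}. \<mu> l *\<^sub>R V l)" "\<forall>l\<in>I - {j}. 0 \<le> \<mu> l"
    using assms(1) unfolding conic_hull_def by blast
  let ?\<mu> = "\<mu>(j := 0)"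
  have "(\<Sum>l\<in>I. ?\<mu> l *\<^sub>R V l) = (\<Sum>l\<in>I - {j}. ?\<mu> l *\<^sub>R V l)"
    by (rule sum.mono_neutral_right) (use assms in auto)
  also have "\<dots> = X" unfolding \<mu>(1) by (rule sum.cong) auto
  finally show ?thesis using that[of ?\<mu>] \<mu>(2) by auto
qed

section \<open>Exchange of generators along linear relations\<close>

text \<open>The ratio test of linear programming: \<open>s\<close> is the least ratio
  \<open>b l / - q l\<close> over the indices with \<open>q l < 0\<close>, the moment when the first
  coordinate reaches zero on the way from \<open>b\<close> in direction \<open>q\<close>.\<close>

lemma first_vanishing_coordinate:
  fixes b q :: "'i \<Rightarrow> real"
  assumes "finite I" and nonneg: "\<And>l. l \<in> I \<Longrightarrow> 0 \<le> b l" and "j \<in> I" "q j < 0"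
  obtains s l where "0 \<le> s" "l \<in> I" "q l < 0" "b l + s * q l = 0"
    "\<And>i. i \<in> I \<Longrightarrow> 0 \<le> b i + s * q i"
proof -
  define N where "N = {l \<in> I. q l < 0}"
  have N: "finite N" "N \<noteq> {}" using assms by (auto simp: N_def)
  obtain l where l: "l \<in> N" "\<And>i. i \<in> N \<Longrightarrow> b l / - q l \<le> b i / - q i"
    using ex_is_arg_min_if_finite[OF N, of "\<lambda>l. b l / - q l"]
    unfolding is_arg_min_linorder by blast
  define s where "s = b l / - q l"
  have ql: "q l < 0" "l \<in> I" using l(1) by (auto simp: N_def)
  then have s: "0 \<le> s" using nonneg[of l] by (simp add: s_def divide_nonneg_neg)
  show ?thesis
  proof (rule that[OF s ql(2) ql(1)])
    show "b l + s * q l = 0" using ql by (simp add: s_def)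
    show "0 \<le> b i + s * q i" if "i \<in> I" for i
    proof (cases "q i < 0")
      case True
      then have "s \<le> b i / - q i" using l(2)[of i] that by (simp add: s_def N_def)
      then have "s * (- q i) \<le> b i" using True pos_le_divide_eq[of "- q i" s "b i"] by simp
      then show ?thesis by simp
    next
      case False
      then show ?thesis using s nonneg[OF that] by simp
    qed
  qed
qed

lemma sum_scaleR_shift:
  "(\<Sum>l\<in>I. b l *\<^sub>R V l) + s *\<^sub>R (\<Sum>l\<in>I. q l *\<^sub>R V l) =
     (\<Sum>l\<in>I. (b l + s * q l) *\<^sub>R (V l :: 'a::real_vector))"
  by (simp add: scaleR_sum_right sum.distrib[symmetric] scaleR_add_left)

lemma conic_hull_dependent:
  fixes V :: "'i \<Rightarrow> 'a::real_vector"
  assumes "finite I" "X \<in> conic_hull V I" "(\<Sum>l\<in>I. c l *\<^sub>R V l) = 0" "j \<in> I" "c j < 0"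
  obtains l where "l \<in> I" "c l < 0" "X \<in> conic_hull V (I - {l})"
proof -
  obtain b where b: "X = (\<Sum>l\<in>I. b l *\<^sub>R V l)" "\<And>l. l \<in> I \<Longrightarrow> 0 \<le> b l"
    using assms(2) unfolding conic_hull_def by blast
  obtain s l where s: "0 \<le> s" "l \<in> I" "c l < 0" "b l + s * c l = 0"
    "\<And>i. i \<in> I \<Longrightarrow> 0 \<le> b i + s * c i"
    using first_vanishing_coordinate[of I b j c, OF assms(1) b(2) assms(4,5)] by blast
  have "X = (\<Sum>l\<in>I. (b l + s * c l) *\<^sub>R V l)"
    using sum_scaleR_shift[of b V I s c] assms(3) b(1) by simp
  then have "X \<in> conic_hull V (I - {l})"
    using conic_hull_delete[of I "\<lambda>i. b i + s * c i" l V] s(4,5) assms(1) by simp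
  then show ?thesis using that s by blast
qed

lemma conic_hull_mono:
  assumes "finite I" "J \<subseteq> I" shows "conic_hull V J \<subseteq> conic_hull V I"
proof
  fix X assume "X \<in> conic_hull V J"
  then obtain \<mu> where \<mu>: "X = (\<Sum>l\<in>J. \<mu> l *\<^sub>R V l)" "\<forall>l\<in>J. 0 \<le> \<mu> l"
    unfolding conic_hull_def by blast
  have "X = (\<Sum>l\<in>I. (if l \<in> J then \<mu> l else 0) *\<^sub>R V l)"
    unfolding \<mu>(1) by (rule sum.mono_neutral_cong_left) (use assms in auto)
  also have "\<dots> \<in> conic_hull V I" using \<mu>(2) by (intro conic_hullI) auto
  finally show "X \<in> conic_hull V I" .
qed

lemma conic_hull_inc: assumes "finite I" "l \<in> I" shows "V l \<in> conic_hull V I"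
proof -
  have "V l = (\<Sum>k\<in>I. (if k = l then 1 else 0) *\<^sub>R V k)"
    using assms by (simp add: if_distrib[where f = "\<lambda>c. c *\<^sub>R _"] cong: if_cong)
  then show ?thesis using conic_hullI[of I "\<lambda>k. if k = l then 1 else 0" V] by auto
qed

lemma conic_hull_add:
  assumes "X \<in> conic_hull V I" "Y \<in> conic_hull V I" shows "X + Y \<in> conic_hull V I"
proof -
  obtain \<mu> \<nu> where "X = (\<Sum>l\<in>I. \<mu> l *\<^sub>R V l)" "Y = (\<Sum>l\<in>I. \<nu> l *\<^sub>R V l)"
    "\<forall>l\<in>I. 0 \<le> \<mu> l" "\<forall>l\<in>I. 0 \<le> \<nu> l" using assms unfolding conic_hull_def by blast
  then show ?thesis using conic_hullI[of I "\<lambda>l. \<mu> l + \<nu> l" V]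
    by (simp add: scaleR_add_left sum.distrib)
qed

lemma conic_hull_scale:
  assumes "X \<in> conic_hull V I" "0 \<le> c" shows "c *\<^sub>R X \<in> conic_hull V I"
proof -
  obtain \<mu> where "X = (\<Sum>l\<in>I. \<mu> l *\<^sub>R V l)" "\<forall>l\<in>I. 0 \<le> \<mu> l"
    using assms unfolding conic_hull_def by blast
  then show ?thesis using conic_hullI[of I "\<lambda>l. c * \<mu> l" V] assms(2)
    by (simp add: scaleR_sum_right)
qed

lemma conic_hull_sum:
  assumes "finite L" "\<And>l. l \<in> L \<Longrightarrow> f l \<in> conic_hull V I"
  shows "(\<Sum>l\<in>L. f l) \<in> conic_hull V I"
  using assms
proof (induction L rule: finite_induct)
  case empty
  show ?case using conic_hullI[of I "\<lambda>_. 0" V] by simp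
qed (auto intro: conic_hull_add)

lemma conic_hull_cong: "(\<And>l. l \<in> I \<Longrightarrow> V l = W l) \<Longrightarrow> conic_hull V I = conic_hull W I"
  unfolding conic_hull_def by (metis (no_types, lifting) sum.cong)

text \<open>Translates a condition on coefficients into independence of a set. Injectivity comes
  along because equal vectors at two indices give the relation with coefficients 1 and -1; it is
  needed to count dimensions.\<close>

lemma independent_family:
  fixes V :: "'i \<Rightarrow> 'a::euclidean_space"
  assumes fin: "finite I" and zero: "\<And>c l. (\<Sum>l\<in>I. c l *\<^sub>R V l) = 0 \<Longrightarrow> l \<in> I \<Longrightarrow> c l = 0"
  shows "inj_on V I" and "independent (V ` I)"
proof -
  show inj: "inj_on V I"
  proof (rule inj_onI, rule ccontr)
    fix i j assume ij: "i \<in> I" "j \<in> I" "V i = V j" "i \<noteq> j"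
    define c :: "'i \<Rightarrow> real" where "c l = (if l = i then 1 else 0) - (if l = j then 1 else 0)" for l
    have "(\<Sum>l\<in>I. c l *\<^sub>R V l) =
        (\<Sum>l\<in>I. (if l = i then V l else 0)) - (\<Sum>l\<in>I. (if l = j then V l else 0))"
      unfolding sum_subtractf[symmetric] by (intro sum.cong) (auto simp: c_def)
    also have "\<dots> = 0" using ij fin by simp
    finally show False using zero[of c i] ij by (simp add: c_def)
  qed
  have "c v = 0" if "(\<Sum>v\<in>V ` I. c v *\<^sub>R v) = 0" "v \<in> V ` I" for c v
    using that zero[of "c \<circ> V"] by (auto simp: sum.reindex[OF inj])
  then show "independent (V ` I)"
    using fin by (simp add: independent_explicit)
qed

lemma dependent_family:
  fixes V :: "'i \<Rightarrow> 'a::euclidean_space"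
  assumes "finite I" "DIM('a) < card I"
  obtains c l where "(\<Sum>l\<in>I. c l *\<^sub>R V l) = 0" "l \<in> I" "c l \<noteq> 0"
proof (rule ccontr)
  assume "\<not> thesis"
  then have *: "\<And>c l. (\<Sum>l\<in>I. c l *\<^sub>R V l) = 0 \<Longrightarrow> l \<in> I \<Longrightarrow> c l = 0" using that by blast
  have "inj_on V I" by (rule independent_family(1)[OF assms(1)]) (rule *)
  then have "card (V ` I) = card I" by (rule card_image)
  moreover have "independent (V ` I)" by (rule independent_family(2)[OF assms(1)]) (rule *)
  ultimately show False using independent_bound[of "V ` I"] assms(2) by simp
qed

section \<open>Sharp open convex cones\<close>

text \<open>Induction over the finite index set, thinning the subsequence once more for each index;
  earlier limits survive the thinning.\<close>

lemma compact_family_convergent_subseq: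
  fixes f :: "nat \<Rightarrow> 'i \<Rightarrow> 'b::metric_space"
  assumes "finite I" "\<And>i. i \<in> I \<Longrightarrow> compact (S i)" "\<And>n i. i \<in> I \<Longrightarrow> f n i \<in> S i"
  shows "\<exists>g r. strict_mono (r :: nat \<Rightarrow> nat) \<and> (\<forall>i\<in>I. g i \<in> S i \<and> (\<lambda>n. f (r n) i) \<longlonglongrightarrow> g i)"
  using assms
proof (induction I rule: finite_induct)
    case empty
    show ?case by (rule exI, rule exI[of _ id]) (auto simp: strict_mono_def)
  next
    case (insert j I)
    have "\<exists>g r. strict_mono (r :: nat \<Rightarrow> nat) \<and> (\<forall>i\<in>I. g i \<in> S i \<and> (\<lambda>n. f (r n) i) \<longlonglongrightarrow> g i)"
      by (rule insert.IH) (use insert.prems in auto)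
    then obtain g and r :: "nat \<Rightarrow> nat" where gr: "strict_mono r"
      "\<forall>i\<in>I. g i \<in> S i \<and> (\<lambda>n. f (r n) i) \<longlonglongrightarrow> g i" by blast
    have "seq_compact (S j)" using insert.prems(1)[of j] by (simp add: compact_eq_seq_compact_metric)
    moreover have "\<forall>n. f (r n) j \<in> S j" using insert.prems(2) by simp
    ultimately obtain l r' where l: "l \<in> S j" "strict_mono (r' :: nat \<Rightarrow> nat)"
      "((\<lambda>n. f (r n) j) \<circ> r') \<longlonglongrightarrow> l" unfolding seq_compact_def by meson
    show ?case
    proof (intro exI[of _ "g(j := l)"] exI[of _ "r \<circ> r'"] conjI ballI)
      show "strict_mono (r \<circ> r')" using gr(1) l(2) by (rule strict_mono_o)
      fix i assume i: "i \<in> insert j I"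
      show "(g(j := l)) i \<in> S i" using i l(1) gr(2) by auto
      show "(\<lambda>n. f ((r \<circ> r') n) i) \<longlonglongrightarrow> (g(j := l)) i"
      proof (cases "i = j")
        case True
        then show ?thesis using l(3) by (simp add: o_def)
      next
        case False
        then have "(\<lambda>n. f (r n) i) \<longlonglongrightarrow> g i" using i gr(2) by blast
        from LIMSEQ_subseq_LIMSEQ[OF this l(2)] show ?thesis using False by (simp add: o_def)
      qed
    qed
  qed

lemma closed_segment_on_line:
  "closed_segment (x + s *\<^sub>R d) (x + t *\<^sub>R d) = (\<lambda>u. x + u *\<^sub>R d) ` closed_segment s t"
  unfolding closed_segment_translation closed_segment_linear_image[OF linear_scaleR_left, of s d t]
  by (simp add: image_image)

lemma open_segment_on_line:
  assumes "d \<noteq> 0"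
  shows "open_segment (x + s *\<^sub>R d) (x + t *\<^sub>R d) = (\<lambda>u. x + u *\<^sub>R d) ` open_segment s t"
proof -
  have "inj (\<lambda>u. u *\<^sub>R d)" using assms by (simp add: inj_def)
  from open_segment_linear_image[OF linear_scaleR_left this, of s t] show ?thesis
    unfolding open_segment_translation by (simp add: image_image)
qed

text \<open>The functional \<open>a\<close> measures height. \<open>height_bound\<close> is proper
  convexity in homogeneous form: the slice of the cone at height 1 is bounded.\<close>

locale sharp_cone =
  fixes C :: "'a::euclidean_space set" and a :: 'a
  assumes open_cone: "open C" and nonempty_cone: "C \<noteq> {}" and convex_cone: "convex C"
    and scale_cone: "\<And>c v. 0 < c \<Longrightarrow> v \<in> C \<Longrightarrow> c *\<^sub>R v \<in> C"
    and height_pos: "\<And>v. v \<in> C \<Longrightarrow> 0 < a \<bullet> v"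
    and height_bound: "\<exists>B. \<forall>v\<in>C. norm v \<le> B * (a \<bullet> v)"
begin

section \<open>Arithmetic and heights in the closed cone\<close>

lemma closure_scale: assumes "0 \<le> c" "v \<in> closure C" shows "c *\<^sub>R v \<in> closure C"
proof -
  have "c *\<^sub>R v \<in> closure C" if c: "0 < c" for c
    using closure_linear_image_subset[of "\<lambda>v. c *\<^sub>R v" C] assms(2) closure_mono[of "(\<lambda>v. c *\<^sub>R v) ` C" C]
      scale_cone[OF c] by (fastforce simp: linear_scaleR)
  moreover have "0 \<in> closure C"
  proof -
    obtain w where w: "w \<in> C" using nonempty_cone by blast
    have "(\<lambda>n. inverse (real (Suc n)) *\<^sub>R w) \<longlonglongrightarrow> 0 *\<^sub>R w"
      by (intro tendsto_scaleR tendsto_const LIMSEQ_inverse_real_of_nat)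
    then show ?thesis
      by (intro closure_sequential[THEN iffD2] exI[of _ "\<lambda>n. inverse (real (Suc n)) *\<^sub>R w"])
        (use w scale_cone in auto)
  qed
  ultimately show ?thesis using assms by (cases "c = 0") auto
qed

lemma zero_in_closure: "0 \<in> closure C"
  using closure_scale[of 0] nonempty_cone closure_subset by fastforce

lemma closure_add:
  assumes "u \<in> closure C" "v \<in> closure C" shows "u + v \<in> closure C"
proof -
  have "(1/2) *\<^sub>R u + (1/2) *\<^sub>R v \<in> closure C"
    using convex_closure[OF convex_cone] assms by (auto simp: convex_def)
  from closure_scale[OF _ this, of 2] show ?thesis by (simp add: scaleR_add_right)
qed

text \<open>The midpoint of an interior point and a closure point of a convex set is interior, and
  doubling it stays in the cone.\<close>

lemma cone_add_closure:
  assumes "u \<in> C" "v \<in> closure C" shows "u + v \<in> C"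
proof -
  have "v - (1/2) *\<^sub>R (v - u) \<in> interior C"
    using assms open_cone interior_open[OF open_cone]
    by (intro mem_interior_closure_convex_shrink[OF convex_cone]) auto
  also have "v - (1/2) *\<^sub>R (v - u) = (1/2) *\<^sub>R (u + v)"
    using scaleR_half_double[of v] by (simp add: algebra_simps)
  finally have "(1/2) *\<^sub>R (u + v) \<in> C" using interior_subset by blast
  from scale_cone[OF _ this, of 2] show ?thesis by simp
qed

lemma conic_hull_closure:
  assumes "finite I" "\<And>l. l \<in> I \<Longrightarrow> V l \<in> closure C" shows "conic_hull V I \<subseteq> closure C"
proof -
  have "(\<Sum>l\<in>I. \<mu> l *\<^sub>R V l) \<in> closure C" if "\<forall>l\<in>I. 0 \<le> \<mu> l" for \<mu>
    using assms that
  proof (induction I rule: finite_induct)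
    case empty
    show ?case by (simp add: zero_in_closure)
  qed (auto intro!: closure_add closure_scale)
  then show ?thesis unfolding conic_hull_def by blast
qed

lemma height_closure:
  obtains B where "\<And>v. v \<in> closure C \<Longrightarrow> norm v \<le> B * (a \<bullet> v)"
proof -
  obtain B where B: "\<forall>v\<in>C. norm v \<le> B * (a \<bullet> v)" using height_bound by blast
  have "closed {v. norm v \<le> B * (a \<bullet> v)}" by (intro closed_Collect_le continuous_intros)
  moreover have "C \<subseteq> {v. norm v \<le> B * (a \<bullet> v)}" using B by auto
  ultimately have "closure C \<subseteq> {v. norm v \<le> B * (a \<bullet> v)}" by (rule closure_minimal[rotated])
  then show ?thesis using that by blast
qed

lemma height_closure_nonneg: assumes "v \<in> closure C" shows "0 \<le> a \<bullet> v"
proof -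
  have "C \<subseteq> {v. 0 \<le> a \<bullet> v}" using height_pos by force
  moreover have "closed {v. 0 \<le> a \<bullet> v}" by (intro closed_Collect_le continuous_intros)
  ultimately have "closure C \<subseteq> {v. 0 \<le> a \<bullet> v}" by (rule closure_minimal)
  then show ?thesis using assms by blast
qed

text \<open>The norm bound extends to the closure, where height zero would force the vector to
  vanish. Hence boundary rays can also be normalised to height 1.\<close>

lemma height_closure_pos: assumes "v \<in> closure C" "v \<noteq> 0" shows "0 < a \<bullet> v"
proof -
  obtain B where "norm v \<le> B * (a \<bullet> v)" using height_closure assms(1) by blast
  then have "a \<bullet> v \<noteq> 0" using assms(2) by auto
  then show ?thesis using height_closure_nonneg[OF assms(1)] by simp
qed

lemma compact_slice: "compact (closure C \<inter> {v. a \<bullet> v = 1})"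
proof -
  obtain B where "\<And>v. v \<in> closure C \<Longrightarrow> norm v \<le> B * (a \<bullet> v)" using height_closure by blast
  then have "bounded (closure C \<inter> {v. a \<bullet> v = 1})"
    by (intro boundedI[of _ B]) force
  moreover have "closed {v. a \<bullet> v = 1}" by (intro closed_Collect_eq continuous_intros)
  ultimately show ?thesis by (simp add: compact_eq_bounded_closed closed_Int)
qed

text \<open>Birkhoff's description of the ball of radius \<open>D\<close> in the Hilbert metric. It makes sense for
  arbitrary lifts and is visibly invariant under linear maps preserving the cone.\<close>

definition birkhoff :: "real \<Rightarrow> 'a \<Rightarrow> 'a \<Rightarrow> bool" where
  "birkhoff D X Y \<longleftrightarrow> (\<exists>\<alpha> \<beta>. 0 < \<alpha> \<and> 0 < \<beta> \<and> \<alpha> * \<beta> \<le> exp (2 * D) \<and>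
     \<alpha> *\<^sub>R Y - X \<in> closure C \<and> \<beta> *\<^sub>R X - Y \<in> closure C)"

lemma birkhoff_mono: "birkhoff D X Y \<Longrightarrow> D \<le> E \<Longrightarrow> birkhoff E X Y"
  unfolding birkhoff_def by (meson exp_le_cancel_iff mult_le_cancel_left_pos order_trans zero_less_numeral)

lemma birkhoff_refl: "0 \<le> D \<Longrightarrow> birkhoff D X X"
  unfolding birkhoff_def by (rule exI[of _ 1], rule exI[of _ 1]) (simp add: zero_in_closure)

lemma birkhoff_scale:
  assumes "birkhoff D X Y" "0 < s" "0 < t" shows "birkhoff D (s *\<^sub>R X) (t *\<^sub>R Y)"
proof -
  obtain \<alpha> \<beta> where ab: "0 < \<alpha>" "0 < \<beta>" "\<alpha> * \<beta> \<le> exp (2 * D)"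
    "\<alpha> *\<^sub>R Y - X \<in> closure C" "\<beta> *\<^sub>R X - Y \<in> closure C" using assms(1) unfolding birkhoff_def by blast
  have "(\<alpha> * s / t) *\<^sub>R (t *\<^sub>R Y) - s *\<^sub>R X \<in> closure C"
    using closure_scale[OF _ ab(4), of s] assms by (simp add: scaleR_diff_right mult.commute)
  moreover have "(\<beta> * t / s) *\<^sub>R (s *\<^sub>R X) - t *\<^sub>R Y \<in> closure C"
    using closure_scale[OF _ ab(5), of t] assms by (simp add: scaleR_diff_right mult.commute)
  ultimately show ?thesis
    unfolding birkhoff_def using ab assms
    by (intro exI[of _ "\<alpha> * s / t"] exI[of _ "\<beta> * t / s"]) auto
qed

lemma birkhoff_linear:
  assumes "linear A" "A ` C = C" "birkhoff D X Y" shows "birkhoff D (A X) (A Y)"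
proof -
  have A: "A v \<in> closure C" if "v \<in> closure C" for v
    using closure_linear_image_subset[OF assms(1), of C] that assms(2) by auto
  obtain \<alpha> \<beta> where ab: "0 < \<alpha>" "0 < \<beta>" "\<alpha> * \<beta> \<le> exp (2 * D)"
    "\<alpha> *\<^sub>R Y - X \<in> closure C" "\<beta> *\<^sub>R X - Y \<in> closure C" using assms(3) unfolding birkhoff_def by blast
  show ?thesis unfolding birkhoff_def
    using ab A[OF ab(4)] A[OF ab(5)] linear_diff[OF assms(1)] linear_cmul[OF assms(1)] by metis
qed

lemma birkhoff_height:
  assumes "\<alpha> *\<^sub>R Y - X \<in> closure C" shows "a \<bullet> X \<le> \<alpha> * (a \<bullet> Y)"
  using height_closure_nonneg[OF assms] by (simp add: inner_diff_right)

section \<open>Limits of simplices under a cocompact action\<close>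

text \<open>Since the cone is open, the limits satisfy both domination conditions with values in
  \<open>C\<close> itself and not only in its closure. Such conditions persist for nearby points
  with the same constants, so one \<open>D\<close> serves a whole tail.\<close>

lemma birkhoff_eventually:
  assumes "X \<in> C" "Y \<in> C" "x \<longlonglongrightarrow> X" "y \<longlonglongrightarrow> Y"
  obtains D where "eventually (\<lambda>n::nat. birkhoff D (x n) (y n)) sequentially"
proof -
  have "\<exists>\<alpha>>0. \<alpha> *\<^sub>R V - U \<in> C" if UV: "U \<in> C" "V \<in> C" for U V
  proof -
    have "(\<lambda>n. V - inverse (real (Suc n)) *\<^sub>R U) \<longlonglongrightarrow> V - 0 *\<^sub>R U"
      by (intro tendsto_intros LIMSEQ_inverse_real_of_nat)
    then have "eventually (\<lambda>n. V - inverse (real (Suc n)) *\<^sub>R U \<in> C) sequentially"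
      using open_cone UV by (auto dest: topological_tendstoD)
    then obtain n where "V - inverse (real (Suc n)) *\<^sub>R U \<in> C"
      by (auto simp: eventually_sequentially)
    from scale_cone[OF _ this, of "real (Suc n)"] show ?thesis
      by (intro exI[of _ "real (Suc n)"]) (simp add: scaleR_diff_right del: of_nat_Suc)
  qed
  then obtain \<alpha> \<beta> where ab: "\<alpha> > 0" "\<beta> > 0" "\<alpha> *\<^sub>R Y - X \<in> C" "\<beta> *\<^sub>R X - Y \<in> C"
    using assms(1,2) by metis
  have "eventually (\<lambda>n. \<alpha> *\<^sub>R y n - x n \<in> C) sequentially"
    by (rule topological_tendstoD[OF _ open_cone ab(3)]) (intro tendsto_intros assms)
  moreover have "eventually (\<lambda>n. \<beta> *\<^sub>R x n - y n \<in> C) sequentially"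
    by (rule topological_tendstoD[OF _ open_cone ab(4)]) (intro tendsto_intros assms)
  ultimately have "eventually (\<lambda>n. birkhoff (ln (\<alpha> * \<beta>) / 2) (x n) (y n)) sequentially"
  proof eventually_elim
    case (elim n)
    then show ?case unfolding birkhoff_def
      using ab closure_subset by (intro exI[of _ \<alpha>] exI[of _ \<beta>]) auto
  qed
  then show ?thesis by (rule that)
qed

text \<open>Automorphisms bring \<open>X n\<close> into \<open>K0\<close>; vertices rescaled to
  height 1 and their coefficients then range over compact sets and converge along a subsequence. If
  a limit facet with index in \<open>J\<close> met the cone, nearby points of the approximating
  facets would stay at bounded distance from \<open>X n\<close>, contradicting \<open>far\<close>.
  Coefficients that are always zero stay zero, so a point on a facet remains on it.\<close>

lemma simplex_limit:
  fixes V :: "nat \<Rightarrow> nat \<Rightarrow> 'a"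
  assumes cpt: "compact K0" "K0 \<subseteq> C"
    and cocompact: "\<And>X. X \<in> C \<Longrightarrow> \<exists>A. linear A \<and> inj A \<and> A ` C = C \<and> A X \<in> K0"
    and fin: "finite I"
    and V: "\<And>n l. l \<in> I \<Longrightarrow> V n l \<in> closure C" "\<And>n l. l \<in> I \<Longrightarrow> V n l \<noteq> 0"
    and X: "\<And>n. X n \<in> C" "\<And>n. X n = (\<Sum>l\<in>I. b n l *\<^sub>R V n l)" "\<And>n l. l \<in> I \<Longrightarrow> 0 \<le> b n l"
    and far: "\<And>n j Y. j \<in> J \<Longrightarrow> Y \<in> conic_hull (V n) (I - {j}) \<Longrightarrow> Y \<in> C \<Longrightarrow> \<not> birkhoff (real n) (X n) Y"
  obtains W Z \<kappa> where "\<And>l. l \<in> I \<Longrightarrow> W l \<in> closure C" "\<And>l. l \<in> I \<Longrightarrow> a \<bullet> W l = 1"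
    "Z \<in> C" "Z = (\<Sum>l\<in>I. \<kappa> l *\<^sub>R W l)" "\<And>l. l \<in> I \<Longrightarrow> 0 \<le> \<kappa> l"
    "\<And>i. i \<in> I \<Longrightarrow> (\<And>n. b n i = 0) \<Longrightarrow> \<kappa> i = 0"
    "\<And>j. j \<in> J \<Longrightarrow> conic_hull W (I - {j}) \<inter> C = {}"
proof -
  obtain A where A: "\<And>n. linear (A n)" "\<And>n. inj (A n)" "\<And>n. A n ` C = C" "\<And>n. A n (X n) \<in> K0"
    using cocompact[OF X(1)] by metis
  have AV: "A n (V n l) \<in> closure C" "0 < a \<bullet> A n (V n l)" if "l \<in> I" for n l
  proof -
    show "A n (V n l) \<in> closure C"
      using closure_linear_image_subset[OF A(1), of n C] V(1)[OF that] A(3) by auto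
    moreover have "A n (V n l) \<noteq> 0"
      using V(2)[OF that, of n] A(2)[of n] linear_injective_0[OF A(1)] by blast
    ultimately show "0 < a \<bullet> A n (V n l)" by (rule height_closure_pos)
  qed
  \<comment> \<open>The factor \<open>h n l\<close> moves from the vertex to its coefficient, so the
    represented point is unchanged.\<close>
  define h where "h n l = a \<bullet> A n (V n l)" for n l
  define W where "W n l = A n (V n l) /\<^sub>R h n l" for n l
  define \<kappa> where "\<kappa> n l = b n l * h n l" for n l
  have h: "0 < h n l" if "l \<in> I" for n l using AV(2)[OF that] by (simp add: h_def)
  have W: "W n l \<in> closure C \<inter> {v. a \<bullet> v = 1}" if "l \<in> I" for n l
    using AV(1)[OF that, of n] h[OF that, of n] closure_scale[of "inverse (h n l)"]
    by (simp add: W_def h_def less_imp_le)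
  have \<kappa>: "0 \<le> \<kappa> n l" if "l \<in> I" for n l using X(3)[OF that] h[OF that] by (simp add: \<kappa>_def less_imp_le)
  have Z: "A n (X n) = (\<Sum>l\<in>I. \<kappa> n l *\<^sub>R W n l)" for n
    unfolding X(2) linear_sum[OF A(1)] \<kappa>_def W_def
    using h by (intro sum.cong refl) (auto simp: linear_cmul[OF A(1)] less_imp_neq[symmetric] dest!: h[of _ n])
  obtain R where R: "\<And>v. v \<in> K0 \<Longrightarrow> a \<bullet> v \<le> R"
  proof -
    have "bounded ((\<lambda>v. a \<bullet> v) ` K0)"
      by (intro compact_imp_bounded compact_continuous_image continuous_intros cpt)
    then obtain R where "\<And>v. v \<in> K0 \<Longrightarrow> norm (a \<bullet> v) \<le> R" unfolding bounded_iff by auto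
    then have "a \<bullet> v \<le> R" if "v \<in> K0" for v using that by force
    then show ?thesis by (rule that)
  qed
  \<comment> \<open>All normalised vertices have height 1, so the coefficients sum to the height of
    \<open>A n (X n)\<close>, which is bounded on \<open>K0\<close>.\<close>
  have \<kappa>R: "\<kappa> n l \<le> R" if "l \<in> I" for n l
  proof -
    have "\<kappa> n l \<le> (\<Sum>l\<in>I. \<kappa> n l)" using \<kappa> that fin by (intro member_le_sum) auto
    also have "\<dots> = (\<Sum>l\<in>I. \<kappa> n l * (a \<bullet> W n l))" using W by (intro sum.cong) auto
    also have "\<dots> = a \<bullet> A n (X n)" unfolding Z by (simp add: inner_sum_right)
    also have "\<dots> \<le> R" using R A(4) by blast
    finally show ?thesis .
  qed
  define S where "S = (closure C \<inter> {v. a \<bullet> v = 1}) \<times> {0..R}"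
  have "compact S" unfolding S_def by (intro compact_Times compact_slice compact_Icc)
  moreover have "(W n l, \<kappa> n l) \<in> S" if "l \<in> I" for n l using W \<kappa> \<kappa>R that by (auto simp: S_def)
  ultimately obtain g and r :: "nat \<Rightarrow> nat" where "strict_mono r"
    "\<forall>l\<in>I. g l \<in> S \<and> (\<lambda>n. (W (r n) l, \<kappa> (r n) l)) \<longlonglongrightarrow> g l"
    using compact_family_convergent_subseq[of I "\<lambda>_. S" "\<lambda>n l. (W n l, \<kappa> n l)", OF fin] by metis
  then have g: "strict_mono r" "\<And>l. l \<in> I \<Longrightarrow> g l \<in> S"
    "\<And>l. l \<in> I \<Longrightarrow> (\<lambda>n. (W (r n) l, \<kappa> (r n) l)) \<longlonglongrightarrow> g l" by blast+
  define W' where "W' l = fst (g l)" for l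
  define \<kappa>' where "\<kappa>' l = snd (g l)" for l
  have lim: "(\<lambda>n. W (r n) l) \<longlonglongrightarrow> W' l" "(\<lambda>n. \<kappa> (r n) l) \<longlonglongrightarrow> \<kappa>' l" if "l \<in> I" for l
    using tendsto_fst[OF g(3)[OF that]] tendsto_snd[OF g(3)[OF that]] by (simp_all add: W'_def \<kappa>'_def)
  define Z' where "Z' = (\<Sum>l\<in>I. \<kappa>' l *\<^sub>R W' l)"
  have Zlim: "(\<lambda>n. A (r n) (X (r n))) \<longlonglongrightarrow> Z'"
    unfolding Z Z'_def by (intro tendsto_sum tendsto_scaleR lim)
  have "Z' \<in> K0"
    using closed_sequentially[OF compact_imp_closed[OF cpt(1)] _ Zlim] A(4) by blast
  then have Z'C: "Z' \<in> C" using cpt(2) by blast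
  show ?thesis
  proof (rule that[of W' Z' \<kappa>'])
    show "W' l \<in> closure C" "a \<bullet> W' l = 1" "0 \<le> \<kappa>' l" if "l \<in> I" for l
      using g(2)[OF that] by (auto simp: S_def W'_def \<kappa>'_def)
    show "Z' \<in> C" "Z' = (\<Sum>l\<in>I. \<kappa>' l *\<^sub>R W' l)" using Z'C Z'_def by auto
    show "\<kappa>' i = 0" if "i \<in> I" "\<And>n. b n i = 0" for i
      using lim(2)[OF that(1)] that(2) by (simp add: \<kappa>_def LIMSEQ_const_iff)
    show "conic_hull W' (I - {j}) \<inter> C = {}" if j: "j \<in> J" for j
    proof (rule ccontr)
      assume "conic_hull W' (I - {j}) \<inter> C \<noteq> {}"
      then obtain \<mu> where \<mu>: "\<forall>l\<in>I - {j}. 0 \<le> \<mu> l" "(\<Sum>l\<in>I - {j}. \<mu> l *\<^sub>R W' l) \<in> C"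
        unfolding conic_hull_def by blast
      define y where "y n = (\<Sum>l\<in>I - {j}. \<mu> l *\<^sub>R W (r n) l)" for n
      have y: "y \<longlonglongrightarrow> (\<Sum>l\<in>I - {j}. \<mu> l *\<^sub>R W' l)"
        unfolding y_def by (intro tendsto_sum tendsto_scaleR tendsto_const lim) auto
      obtain D where D: "eventually (\<lambda>n. birkhoff D (A (r n) (X (r n))) (y n)) sequentially"
        using birkhoff_eventually[OF Z'C \<mu>(2) Zlim y] by blast
      have "eventually (\<lambda>n. y n \<in> C) sequentially"
        using topological_tendstoD[OF y open_cone \<mu>(2)] .
      moreover have "eventually (\<lambda>n. D \<le> real n) sequentially"
        by (rule eventually_sequentiallyI[of "nat \<lceil>D\<rceil>"]) linarith
      ultimately obtain n where n: "birkhoff D (A (r n) (X (r n))) (y n)" "y n \<in> C" "D \<le> real n"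
        using D eventually_happens[OF eventually_conj[OF D eventually_conj]] by force
      \<comment> \<open>The preimage of \<open>y n\<close> under the automorphism: dividing by
        \<open>h\<close> undoes the normalisation, so it lies on the facet of the original
        simplex.\<close>
      define y' where "y' = (\<Sum>l\<in>I - {j}. (\<mu> l / h (r n) l) *\<^sub>R V (r n) l)"
      have Ay': "A (r n) y' = y n"
        unfolding y'_def y_def linear_sum[OF A(1)] W_def linear_cmul[OF A(1)]
        by (simp add: divide_inverse)
      have inj: "y' \<in> C"
        using n(2) A(2)[of "r n"] A(3)[of "r n"] unfolding Ay'[symmetric] by (metis image_iff injD)
      define B where "B = inv (A (r n))"
      have B: "linear B" "B ` C = C" "\<And>v. B (A (r n) v) = v"
      proof -
        show "linear B" unfolding B_def using A(1,2) by (rule inj_linear_imp_inv_linear)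
        have "B ` (A (r n) ` C) = C" unfolding B_def by (rule image_inv_f_f[OF A(2)])
        then show "B ` C = C" unfolding A(3) .
        show "B (A (r n) v) = v" for v unfolding B_def by (rule inv_f_f[OF A(2)])
      qed
      have "birkhoff D (X (r n)) y'"
        using birkhoff_linear[OF B(1,2) n(1)] unfolding Ay'[symmetric] B(3) .
      \<comment> \<open>The hypothesis \<open>far\<close> is indexed by the original sequence, hence
        the passage from \<open>n\<close> to \<open>r n\<close>, which is at least
        \<open>n\<close>.\<close>
      moreover have "D \<le> real (r n)" using n(3) seq_suble[OF g(1), of n] by linarith
      ultimately have "birkhoff (real (r n)) (X (r n)) y'" by (rule birkhoff_mono)
      moreover have "y' \<in> conic_hull (V (r n)) (I - {j})"
        unfolding y'_def using \<mu>(1) h by (intro conic_hullI) (auto intro!: divide_nonneg_pos)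
      ultimately show False using far[OF j] inj by blast
    qed
  qed
qed

section \<open>Independence and exchange of facets\<close>

text \<open>A nontrivial relation, with its sign chosen so that the coefficient at \<open>l\<close>
  is negative, would move \<open>Z\<close> onto a facet by \<open>conic_hull_dependent\<close>,
  although the facets miss the cone. This is the source of nondegeneracy for the limit
  simplex.\<close>

lemma facet_avoiding_independent:
  assumes fin: "finite I" and Z: "Z \<in> C" "Z \<in> conic_hull W I"
    and avoid: "\<And>j. j \<in> I \<Longrightarrow> conic_hull W (I - {j}) \<inter> C = {}"
    and c: "(\<Sum>l\<in>I. c l *\<^sub>R W l) = 0" and l: "l \<in> I"
  shows "c l = 0"
proof -
  have *: False if "(\<Sum>l\<in>I. c l *\<^sub>R W l) = 0" "c l < 0" for c
    using conic_hull_dependent[OF fin Z(2) that(1) l that(2)] avoid Z(1) by blast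
  have "(\<Sum>l\<in>I. (- c l) *\<^sub>R W l) = 0" using c by (simp add: sum_negf)
  then show ?thesis using *[of c] *[of "\<lambda>l. - c l"] c by force
qed

text \<open>Choose the sign of the relation so that its coefficient at \<open>i\<close> is
  nonnegative. The generator dropped by Caratheodory's reduction has a negative coefficient, hence
  differs from \<open>i\<close>.\<close>

lemma dependent_facet_swap:
  assumes fin: "finite I" and X: "X \<in> conic_hull V (I - {i})"
    and V: "\<And>l. l \<in> I \<Longrightarrow> 0 < a \<bullet> V l"
    and c: "(\<Sum>l\<in>I. c l *\<^sub>R V l) = 0" and m: "m \<in> I" "c m \<noteq> 0"
  obtains j where "j \<in> I" "j \<noteq> i" "X \<in> conic_hull V (I - {j})"
proof -
  have X': "X \<in> conic_hull V I" using X conic_hull_mono[OF fin, of "I - {i}" V] by blast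
  have *: "\<exists>j\<in>I. j \<noteq> i \<and> X \<in> conic_hull V (I - {j})"
    if c: "(\<Sum>l\<in>I. c l *\<^sub>R V l) = 0" "0 \<le> c i" "c m \<noteq> 0" for c
  proof -
    \<comment> \<open>All heights are positive, so a nontrivial relation cannot have only
      nonnegative coefficients.\<close>
    have "\<exists>j\<in>I. c j < 0"
    proof (rule ccontr)
      assume "\<not> (\<exists>j\<in>I. c j < 0)"
      then have nn: "0 \<le> c l * (a \<bullet> V l)" if "l \<in> I" for l using that V[OF that] by (simp add: not_less)
      have "(\<Sum>l\<in>I. c l * (a \<bullet> V l)) = a \<bullet> (\<Sum>l\<in>I. c l *\<^sub>R V l)" by (simp add: inner_sum_right)
      then have "(\<Sum>l\<in>I. c l * (a \<bullet> V l)) = 0" using c(1) by simp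
      then have "c m * (a \<bullet> V m) = 0" using sum_nonneg_0[OF fin, of "\<lambda>l. c l * (a \<bullet> V l)" m] nn m(1) by blast
      then show False using c(3) V[OF m(1)] by simp
    qed
    then obtain j where j: "j \<in> I" "c j < 0" by blast
    obtain l where "l \<in> I" "c l < 0" "X \<in> conic_hull V (I - {l})"
      by (rule conic_hull_dependent[OF fin X' c(1) j])
    then show ?thesis using c(2) by force
  qed
  have "(\<Sum>l\<in>I. (- c l) *\<^sub>R V l) = 0" using c by (simp add: sum_negf)
  then have "\<exists>j\<in>I. j \<noteq> i \<and> X \<in> conic_hull V (I - {j})"
    using *[of c] *[of "\<lambda>l. - c l"] c m(2) by (cases "0 \<le> c i") auto
  then show ?thesis using that by blast
qed

text \<open>The first limit produces a simplex with one facet through the cone and the others on its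
  boundary. Moving from the good facet towards the opposite vertex and passing to the limit once
  more pushes that facet to the boundary too.\<close>

lemma boundary_simplex_of_fat_simplices:
  fixes V :: "nat \<Rightarrow> nat \<Rightarrow> 'a"
  assumes cpt: "compact K0" "K0 \<subseteq> C"
    and cocompact: "\<And>X. X \<in> C \<Longrightarrow> \<exists>A. linear A \<and> inj A \<and> A ` C = C \<and> A X \<in> K0"
    and fin: "finite I" and i: "i \<in> I"
    and V: "\<And>n l. l \<in> I \<Longrightarrow> V n l \<in> closure C" "\<And>n l. l \<in> I \<Longrightarrow> V n l \<noteq> 0"
    and X: "\<And>n. X n \<in> C" "\<And>n. X n \<in> conic_hull (V n) (I - {i})"
    and far: "\<And>n j Y. j \<in> I - {i} \<Longrightarrow> Y \<in> conic_hull (V n) (I - {j}) \<Longrightarrow> Y \<in> C \<Longrightarrow>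
      \<not> birkhoff (real n) (X n) Y"
  obtains W Z where "\<And>l. l \<in> I \<Longrightarrow> W l \<in> closure C" "\<And>l. l \<in> I \<Longrightarrow> a \<bullet> W l = 1"
    "Z \<in> C" "Z \<in> conic_hull W I" "\<And>j. j \<in> I \<Longrightarrow> conic_hull W (I - {j}) \<inter> C = {}"
proof -
  have "\<exists>t. X n = (\<Sum>l\<in>I. t l *\<^sub>R V n l) \<and> (\<forall>l\<in>I. 0 \<le> t l) \<and> t i = 0" for n
    using conic_hull_deleteE[OF X(2) fin, of n] by metis
  then obtain t where t: "\<And>n. X n = (\<Sum>l\<in>I. t n l *\<^sub>R V n l)" "\<And>n l. l \<in> I \<Longrightarrow> 0 \<le> t n l"
    "\<And>n. t n i = 0" by metis
  obtain W Z \<kappa> where W: "\<And>l. l \<in> I \<Longrightarrow> W l \<in> closure C" "\<And>l. l \<in> I \<Longrightarrow> a \<bullet> W l = 1"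
    and Z: "Z \<in> C" "Z = (\<Sum>l\<in>I. \<kappa> l *\<^sub>R W l)" and \<kappa>: "\<And>l. l \<in> I \<Longrightarrow> 0 \<le> \<kappa> l"
    "\<And>i. i \<in> I \<Longrightarrow> (\<And>n. t n i = 0) \<Longrightarrow> \<kappa> i = 0"
    and avoid: "\<And>j. j \<in> I - {i} \<Longrightarrow> conic_hull W (I - {j}) \<inter> C = {}"
    by (rule simplex_limit[OF cpt cocompact fin V X(1) t(1,2) far, of "I - {i}"]) blast+
  have \<kappa>i: "\<kappa> i = 0" using \<kappa>(2)[OF i] t(3) by blast
  \<comment> \<open>Moving from \<open>Z\<close> in direction \<open>q\<close> never leaves the
    cone. A negative coefficient would make the path hit a facet whose index is not
    \<open>i\<close>, because \<open>q i\<close> is positive, and those facets miss the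
    cone.\<close>
  have wedge: "0 \<le> q j"
    if q: "(\<Sum>l\<in>I. q l *\<^sub>R W l) \<in> closure C" "0 < q i" and j: "j \<in> I" for q j
  proof (rule ccontr)
    assume "\<not> 0 \<le> q j"
    then have "q j < 0" by simp
    then obtain s l where s: "0 \<le> s" "l \<in> I" "q l < 0" "\<kappa> l + s * q l = 0"
      "\<And>i. i \<in> I \<Longrightarrow> 0 \<le> \<kappa> i + s * q i"
      using first_vanishing_coordinate[of I \<kappa> j q, OF fin \<kappa>(1) j] by blast
    have "Z + s *\<^sub>R (\<Sum>l\<in>I. q l *\<^sub>R W l) \<in> C"
      using cone_add_closure[OF Z(1) closure_scale[OF s(1) q(1)]] .
    moreover have "Z + s *\<^sub>R (\<Sum>l\<in>I. q l *\<^sub>R W l) \<in> conic_hull W (I - {l})"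
      unfolding Z(2) sum_scaleR_shift using s(4,5) fin by (intro conic_hull_delete) auto
    moreover have "l \<noteq> i" using q(2) s(3) by auto
    ultimately show False using avoid[of l] s(2) by blast
  qed
  define h where "h = a \<bullet> Z"
  have h: "0 < h" using height_pos[OF Z(1)] by (simp add: h_def)
  \<comment> \<open>The multiple of \<open>W i\<close> is chosen so that the height of
    \<open>Y n\<close> is \<open>h + h * exp (2 * real n)\<close>, just above what distance
    \<open>n\<close> from the facet opposite \<open>W i\<close> would permit.\<close>
  define Y where "Y n = Z + (h * exp (2 * real n)) *\<^sub>R W i" for n
  define u where "u n l = (if l = i then h * exp (2 * real n) else 0)" for n l
  have uW: "(\<Sum>l\<in>I. u n l *\<^sub>R W l) = (h * exp (2 * real n)) *\<^sub>R W i" for n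
    using fin i by (simp add: u_def if_distrib[where f = "\<lambda>c. c *\<^sub>R _"] cong: if_cong)
  have Y: "Y n = (\<Sum>l\<in>I. (\<kappa> l + u n l) *\<^sub>R W l)" for n
    unfolding Y_def uW[symmetric] Z(2) by (simp add: scaleR_add_left sum.distrib)
  have YC: "Y n \<in> C" for n
    unfolding Y_def using h W(1)[OF i] by (intro cone_add_closure Z closure_scale) auto
  have far_i: "\<not> birkhoff (real n) (Y n) T" if T: "T \<in> conic_hull W (I - {i})" "T \<in> C" for n T
  proof
    assume "birkhoff (real n) (Y n) T"
    then obtain \<alpha> \<beta> where ab: "0 < \<alpha>" "0 < \<beta>" "\<alpha> * \<beta> \<le> exp (2 * real n)"
      "\<alpha> *\<^sub>R T - Y n \<in> closure C" "\<beta> *\<^sub>R Y n - T \<in> closure C" unfolding birkhoff_def by blast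
    obtain \<mu> where \<mu>: "T = (\<Sum>l\<in>I. \<mu> l *\<^sub>R W l)" "\<And>l. l \<in> I \<Longrightarrow> 0 \<le> \<mu> l" "\<mu> i = 0"
      using conic_hull_deleteE[OF T(1) fin] by blast
    define q where "q l = \<beta> * (\<kappa> l + u n l) - \<mu> l" for l
    have "(\<Sum>l\<in>I. q l *\<^sub>R W l) = \<beta> *\<^sub>R Y n - T"
      unfolding Y \<mu>(1) q_def by (simp add: scaleR_sum_right sum_subtractf scaleR_diff_left)
    moreover have "0 < q i" using ab(2) h by (simp add: q_def \<kappa>i \<mu>(3) u_def)
    ultimately have q: "0 \<le> q l" if "l \<in> I" for l using wedge[of q l] ab(5) that by simp
    \<comment> \<open>By \<open>wedge\<close> the bound holds coefficient by coefficient, and the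
      large \<open>i\<close>-th coefficient of \<open>Y n\<close> does not enter since
      \<open>T\<close> has none. So the height of \<open>T\<close> is compared with that of
      \<open>Z\<close> instead of that of \<open>Y n\<close>, which makes the product of the two
      constants too large.\<close>
    have "0 \<le> (\<Sum>l\<in>I. \<beta> * \<kappa> l - \<mu> l)"
    proof (rule sum_nonneg)
      fix l assume "l \<in> I"
      then show "0 \<le> \<beta> * \<kappa> l - \<mu> l" using q[of l] by (cases "l = i") (auto simp: q_def u_def \<kappa>i \<mu>(3))
    qed
    moreover have "h = (\<Sum>l\<in>I. \<kappa> l)" unfolding h_def Z(2) by (simp add: inner_sum_right W(2))
    moreover have "a \<bullet> T = (\<Sum>l\<in>I. \<mu> l)" unfolding \<mu>(1) by (simp add: inner_sum_right W(2))
    ultimately have 1: "a \<bullet> T \<le> \<beta> * h" by (simp add: sum_subtractf sum_distrib_left)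
    have "a \<bullet> Y n = h + h * exp (2 * real n)" by (simp add: Y_def inner_add_right W(2)[OF i] h_def)
    then have "h + h * exp (2 * real n) \<le> \<alpha> * (a \<bullet> T)" using birkhoff_height[OF ab(4)] by simp
    also have "\<dots> \<le> \<alpha> * (\<beta> * h)" using 1 ab(1) by simp
    also have "\<dots> \<le> h * exp (2 * real n)" using ab(3) h by (simp add: mult.assoc[symmetric] mult.commute[of _ h])
    finally show False using h by simp
  qed
  \<comment> \<open>For \<open>j \<noteq> i\<close> the facet already misses the cone and the claim
    is vacuous.\<close>
  have far': "\<not> birkhoff (real n) (Y n) T" if "j \<in> I" "T \<in> conic_hull W (I - {j})" "T \<in> C" for n j T
    using that far_i avoid[of j] by (cases "j = i") blast+
  have nn: "0 \<le> \<kappa> l + u n l" if "l \<in> I" for n l using \<kappa>(1)[OF that] h by (simp add: u_def)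
  have W0: "W l \<noteq> 0" if "l \<in> I" for l using W(2)[OF that] by auto
  obtain W' Z' \<kappa>' where "\<And>l. l \<in> I \<Longrightarrow> W' l \<in> closure C" "\<And>l. l \<in> I \<Longrightarrow> a \<bullet> W' l = 1"
    "Z' \<in> C" "Z' = (\<Sum>l\<in>I. \<kappa>' l *\<^sub>R W' l)" "\<And>l. l \<in> I \<Longrightarrow> 0 \<le> \<kappa>' l"
    "\<And>j. j \<in> I \<Longrightarrow> conic_hull W' (I - {j}) \<inter> C = {}"
    by (rule simplex_limit[OF cpt cocompact fin W(1) W0 YC Y nn far', of I]) blast+
  then show ?thesis using that[of W' Z'] conic_hullI[of I \<kappa>' W'] by blast
qed

text \<open>Cut the corner of a boundary simplex at vertex \<open>i\<close> by a hyperplane through the interior point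
  \<open>Y\<close>, and shrink the resulting simplex slightly towards \<open>Y\<close>.\<close>

lemma fat_simplex_of_boundary_simplex:
  assumes fin: "finite I" and i: "i \<in> I" "I \<noteq> {i}"
    and W: "\<And>l. l \<in> I \<Longrightarrow> W l \<in> closure C" "\<And>l. l \<in> I \<Longrightarrow> a \<bullet> W l = 1"
    and Z: "Z \<in> C" "Z \<in> conic_hull W I"
    and avoid: "\<And>j. j \<in> I \<Longrightarrow> conic_hull W (I - {j}) \<inter> C = {}"
  obtains U Y where "\<And>l. l \<in> I \<Longrightarrow> U l \<in> C" "\<And>l. l \<in> I \<Longrightarrow> a \<bullet> U l = 1"
    "Y \<in> C" "Y \<in> conic_hull U (I - {i})"
    "\<And>j T. j \<in> I - {i} \<Longrightarrow> T \<in> conic_hull U (I - {j}) \<Longrightarrow> T \<in> C \<Longrightarrow> \<not> birkhoff D Y T"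
proof -
  define Y where "Y = Z /\<^sub>R (a \<bullet> Z)"
  have aZ: "0 < a \<bullet> Z" using height_pos[OF Z(1)] .
  have Y: "Y \<in> C" "a \<bullet> Y = 1" "Y \<in> conic_hull W I"
    using aZ scale_cone[of "inverse (a \<bullet> Z)" Z] Z conic_hull_scale[OF Z(2), of "inverse (a \<bullet> Z)"]
    by (auto simp: Y_def)
  obtain b where b: "Y = (\<Sum>l\<in>I. b l *\<^sub>R W l)" "\<And>l. l \<in> I \<Longrightarrow> 0 \<le> b l"
    using Y(3) unfolding conic_hull_def by blast
  \<comment> \<open>A vanishing coefficient would place \<open>Y\<close> on a facet, but facets miss
    the cone.\<close>
  have bpos: "0 < b l" if "l \<in> I" for l
  proof (rule ccontr)
    assume "\<not> 0 < b l"
    then have "b l = 0" using b(2)[OF that] by simp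
    then have "Y \<in> conic_hull W (I - {l})" unfolding b(1) by (intro conic_hull_delete fin b) auto
    then show False using avoid[OF that] Y(1) by blast
  qed
  have "(\<Sum>l\<in>I. b l) = 1" using Y(2) unfolding b(1) by (simp add: inner_sum_right W(2))
  then have bsum: "(\<Sum>l\<in>I - {i}. b l) = 1 - b i" using sum.remove[OF fin i(1), of b] by simp
  have "0 < (\<Sum>l\<in>I - {i}. b l)" using bpos i fin by (intro sum_pos) auto
  then have bi: "b i < 1" using bsum by simp
  \<comment> \<open>The absolute value covers negative \<open>D\<close> as well; the factor 1/2
    makes the inequalities strict.\<close>
  define e where "e = exp (- 2 * \<bar>D\<bar>) / 2"
  have e: "0 < e" "e < 1" "e * exp (2 * D) < 1"
  proof -
    have "exp (- 2 * \<bar>D\<bar>) \<le> 1" by simp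
    then show "0 < e" "e < 1" using exp_gt_zero[of "- 2 * \<bar>D\<bar>"] unfolding e_def by linarith+
    have "exp (- 2 * \<bar>D\<bar>) * exp (2 * D) \<le> 1" unfolding exp_add[symmetric] by simp
    then show "e * exp (2 * D) < 1" by (simp add: e_def)
  qed
  \<comment> \<open>For \<open>l \<noteq> i\<close> this is the point on the edge from
    \<open>W i\<close> to \<open>W l\<close> whose \<open>W i\<close>-weight equals that of
    \<open>Y\<close>; these points span the cutting hyperplane section through
    \<open>Y\<close>.\<close>
  define P where "P l = (if l = i then W i else b i *\<^sub>R W i + (1 - b i) *\<^sub>R W l)" for l
  define U where "U l = (1 - e) *\<^sub>R P l + e *\<^sub>R Y" for l
  have P: "P l \<in> closure C" "a \<bullet> P l = 1" if "l \<in> I" for l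
    using W that i bi bpos[OF i(1)] unfolding P_def
    by (auto intro!: closure_add closure_scale simp: inner_add_right)
  have U: "U l \<in> C" "a \<bullet> U l = 1" if "l \<in> I" for l
  proof -
    show "U l \<in> C" unfolding U_def add.commute[of "(1 - e) *\<^sub>R P l"]
      using e P[OF that] by (intro cone_add_closure scale_cone Y closure_scale) auto
    show "a \<bullet> U l = 1" using P(2)[OF that] Y(2) by (simp add: U_def inner_add_right)
  qed
  have "(\<Sum>l\<in>I - {i}. (b l / (1 - b i)) *\<^sub>R P l) =
      (\<Sum>l\<in>I - {i}. (b l / (1 - b i) * b i) *\<^sub>R W i + b l *\<^sub>R W l)"
    using bi by (intro sum.cong) (auto simp: P_def scaleR_add_right)
  also have "\<dots> = ((\<Sum>l\<in>I - {i}. b l) / (1 - b i) * b i) *\<^sub>R W i + (\<Sum>l\<in>I - {i}. b l *\<^sub>R W l)"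
    by (simp add: sum.distrib scaleR_left.sum[symmetric] sum_distrib_right sum_divide_distrib)
  also have "\<dots> = Y" using bi sum.remove[OF fin i(1), of "\<lambda>l. b l *\<^sub>R W l"] by (simp add: bsum b(1))
  finally have "(\<Sum>l\<in>I - {i}. (b l / (1 - b i)) *\<^sub>R P l) = Y" .
  moreover have "(\<Sum>l\<in>I - {i}. (b l / (1 - b i)) *\<^sub>R U l) =
      (1 - e) *\<^sub>R (\<Sum>l\<in>I - {i}. (b l / (1 - b i)) *\<^sub>R P l) + e *\<^sub>R ((\<Sum>l\<in>I - {i}. b l / (1 - b i)) *\<^sub>R Y)"
    unfolding U_def scaleR_sum_right scaleR_left.sum sum.distrib[symmetric]
    by (intro sum.cong) (auto simp: scaleR_add_right mult.commute)
  moreover have "(\<Sum>l\<in>I - {i}. b l / (1 - b i)) = 1" using bi by (simp add: sum_divide_distrib[symmetric] bsum)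
  ultimately have "(\<Sum>l\<in>I - {i}. (b l / (1 - b i)) *\<^sub>R U l) = Y"
    by (simp add: scaleR_add_left[symmetric])
  then have YU: "Y \<in> conic_hull U (I - {i})"
    using conic_hullI[of "I - {i}" "\<lambda>l. b l / (1 - b i)" U] b(2) bi by auto
  have "\<not> birkhoff D Y T" if j: "j \<in> I - {i}" and T: "T \<in> conic_hull U (I - {j})" "T \<in> C" for j T
  proof
    assume "birkhoff D Y T"
    then obtain \<alpha> \<beta> where ab: "0 < \<alpha>" "0 < \<beta>" "\<alpha> * \<beta> \<le> exp (2 * D)"
      "\<alpha> *\<^sub>R T - Y \<in> closure C" "\<beta> *\<^sub>R Y - T \<in> closure C" unfolding birkhoff_def by blast
    obtain \<mu> where \<mu>: "T = (\<Sum>l\<in>I - {j}. \<mu> l *\<^sub>R U l)" "\<forall>l\<in>I - {j}. 0 \<le> \<mu> l"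
      using T(1) unfolding conic_hull_def by blast
    define M where "M = (\<Sum>l\<in>I - {j}. \<mu> l)"
    define Q where "Q = (\<Sum>l\<in>I - {j}. \<mu> l *\<^sub>R P l)"
    have "a \<bullet> T = M" unfolding \<mu>(1) M_def by (simp add: inner_sum_right U(2))
    then have M: "M \<le> \<beta>" "0 < M" using birkhoff_height[OF ab(5)] Y(2) height_pos[OF T(2)] by auto
    have TQ: "T = (1 - e) *\<^sub>R Q + (e * M) *\<^sub>R Y"
      unfolding \<mu>(1) U_def Q_def M_def
      by (simp add: scaleR_add_right sum.distrib scaleR_sum_right scaleR_left.sum sum_distrib_left mult.commute)
    \<comment> \<open>\<open>P l\<close> only involves \<open>W i\<close> and \<open>W l\<close>,
      both different from the vertex \<open>W j\<close>. So the unshrunk facet lies in a facet of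
      the boundary simplex.\<close>
    have "P l \<in> conic_hull W (I - {j})" if "l \<in> I - {j}" for l
      unfolding P_def using that j i bi b(2)[OF i(1)] fin
      by (auto intro!: conic_hull_add conic_hull_scale conic_hull_inc)
    then have "Q \<in> conic_hull W (I - {j})"
      unfolding Q_def using \<mu>(2) fin by (intro conic_hull_sum conic_hull_scale) auto
    then have "Q \<notin> C" using avoid j by blast
    \<comment> \<open>In \<open>\<alpha> *\<^sub>R T - Y\<close> the total coefficient of
      \<open>Y\<close> is \<open>\<alpha> * e * M - 1\<close>. If it were negative, cancelling it by
      adding a positive multiple of \<open>Y\<close> would put a positive multiple of
      \<open>Q\<close> into the cone.\<close>
    have "1 \<le> \<alpha> * e * M"
    proof (rule ccontr)
      assume less: "\<not> 1 \<le> \<alpha> * e * M"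
      have "(1 - \<alpha> * e * M) *\<^sub>R Y + (\<alpha> *\<^sub>R T - Y) \<in> C"
        using less by (intro cone_add_closure scale_cone Y ab) auto
      also have "(1 - \<alpha> * e * M) *\<^sub>R Y + (\<alpha> *\<^sub>R T - Y) = (\<alpha> * (1 - e)) *\<^sub>R Q"
        unfolding TQ by (simp add: algebra_simps)
      finally have QC: "(\<alpha> * (1 - e)) *\<^sub>R Q \<in> C" .
      have *: "Q \<in> C" if "0 < c" "c *\<^sub>R Q \<in> C" for c :: real
        using scale_cone[OF _ that(2), of "inverse c"] that(1) by simp
      have "Q \<in> C" by (rule *[OF _ QC]) (use ab(1) e in simp)
      then show False using \<open>Q \<notin> C\<close> by simp
    qed
    also have "\<alpha> * e * M \<le> e * (\<alpha> * \<beta>)" using M ab e by simp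
    also have "\<dots> \<le> e * exp (2 * D)" using ab(3) e by simp
    finally show False using e(3) by simp
  qed
  then show ?thesis using that[of U Y] U Y(1) YU by blast
qed

section \<open>Chords and cross-ratios\<close>

text \<open>The parameters of the closed cone on the line form a compact convex set, hence an
  interval. Those of the open cone form an open subset and so avoid its endpoints.\<close>

lemma chord_interval:
  assumes X: "X \<in> C" "a \<bullet> X = 1" and Y: "Y \<in> C" "a \<bullet> Y = 1" and "X \<noteq> Y"
  obtains p q where "p < 0" "1 < q" "X + p *\<^sub>R (Y - X) \<notin> C" "X + q *\<^sub>R (Y - X) \<notin> C"
    "\<And>t. X + t *\<^sub>R (Y - X) \<in> closure C \<longleftrightarrow> p \<le> t \<and> t \<le> q"
proof -
  define f where "f t = X + t *\<^sub>R (Y - X)" for t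
  define T where "T = {t. f t \<in> closure C}"
  have cont: "continuous_on UNIV f" unfolding f_def by (intro continuous_intros)
  have af: "a \<bullet> f t = 1" for t by (simp add: f_def inner_add_right inner_diff_right X Y)
  have "f -` closure C = T" by (auto simp: T_def)
  then have "closed T" using continuous_closed_vimage[OF closed_closure, of f C] cont
    by (simp add: continuous_on_eq_continuous_at)
  moreover have "bounded T"
  proof -
    obtain B where B: "\<And>v. v \<in> closure C \<Longrightarrow> norm v \<le> B * (a \<bullet> v)" using height_closure by blast
    have "\<bar>t\<bar> \<le> (B + norm X) / norm (Y - X)" if "t \<in> T" for t
    proof -
      have "norm (f t) \<le> B" using B[of "f t"] that af by (simp add: T_def)
      moreover have "t *\<^sub>R (Y - X) = f t - X" by (simp add: f_def)
      then have "\<bar>t\<bar> * norm (Y - X) \<le> norm (f t) + norm X" by (metis norm_scaleR norm_triangle_ineq4)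
      ultimately show ?thesis using assms(5) by (simp add: field_simps)
    qed
    then show ?thesis by (intro boundedI) auto
  qed
  ultimately have "compact T" by (simp add: compact_eq_bounded_closed)
  moreover have "convex T"
  proof (rule convexI)
    fix s t u w assume st: "s \<in> T" "t \<in> T" "0 \<le> u" "0 \<le> w" "u + w = (1::real)"
    have "u *\<^sub>R f s + w *\<^sub>R f t \<in> closure C"
      using convexD[OF convex_closure[OF convex_cone]] st by (simp add: T_def)
    moreover have "u *\<^sub>R f s + w *\<^sub>R f t = (u + w) *\<^sub>R X + (u * s + w * t) *\<^sub>R (Y - X)"
      by (simp add: f_def algebra_simps)
    ultimately show "u *\<^sub>R s + w *\<^sub>R t \<in> T" using st by (simp add: T_def f_def)
  qed
  ultimately obtain p q where T: "T = {p..q}"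
    using is_interval_compact[of T] by (auto simp: is_interval_convex_1)
  have op: "open (f -` C)" using open_vimage[OF open_cone cont] .
  have sub: "f -` C \<subseteq> T" using closure_subset by (auto simp: T_def)
  have ends: "f p \<notin> C" "f q \<notin> C"
  proof -
    have "interior T = {p<..<q}" unfolding T by simp
    moreover have "f -` C \<subseteq> interior T" using op sub by (rule interior_maximal[rotated])
    ultimately show "f p \<notin> C" "f q \<notin> C" by auto
  qed
  have "f 0 = X" "f 1 = Y" by (auto simp: f_def)
  then have "0 \<in> T" "1 \<in> T" "p \<noteq> 0" "q \<noteq> 1" using X Y ends sub by auto
  then have "p < 0" "1 < q" by (auto simp: T)
  moreover have "f t \<in> closure C \<longleftrightarrow> p \<le> t \<and> t \<le> q" for t using T by (auto simp: T_def)
  ultimately show ?thesis using that ends unfolding f_def by blast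
qed

lemma birkhoff_nonneg:
  assumes "birkhoff D X Y" "a \<bullet> X = 1" "a \<bullet> Y = 1" shows "0 \<le> D"
proof -
  obtain \<alpha> \<beta> where ab: "0 < \<alpha>" "0 < \<beta>" "\<alpha> * \<beta> \<le> exp (2 * D)"
    "\<alpha> *\<^sub>R Y - X \<in> closure C" "\<beta> *\<^sub>R X - Y \<in> closure C"
    using assms(1) unfolding birkhoff_def by blast
  have "1 \<le> \<alpha>" "1 \<le> \<beta>" using birkhoff_height[OF ab(4)] birkhoff_height[OF ab(5)] assms by simp_all
  then have "1 \<le> \<alpha> * \<beta>" using mult_mono[of 1 \<alpha> 1 \<beta>] by simp
  then have "1 \<le> exp (2 * D)" using ab(3) by (rule order_trans)
  then show ?thesis by simp
qed

text \<open>Up to the factor \<open>\<alpha> - 1\<close>, the vector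
  \<open>\<alpha> *\<^sub>R Y - X\<close> is the point of the line with parameter
  \<open>\<alpha> / (\<alpha> - 1)\<close>, so the least admissible constant is
  \<open>q / (q - 1)\<close>; symmetrically for \<open>\<beta>\<close> and \<open>p\<close>. The
  product of the two least constants is the cross-ratio.\<close>

lemma birkhoff_chord:
  assumes X: "X \<in> C" "a \<bullet> X = 1" and Y: "Y \<in> C" "a \<bullet> Y = 1" and "X \<noteq> Y"
    and pq: "p < 0" "1 < q" and chord: "\<And>t. X + t *\<^sub>R (Y - X) \<in> closure C \<longleftrightarrow> p \<le> t \<and> t \<le> q"
  shows "birkhoff D X Y \<longleftrightarrow> ((1 - p) * q) / ((- p) * (q - 1)) \<le> exp (2 * D)"
proof -
  have Y_X: "Y - X \<notin> closure C" if "a \<bullet> X = 1" "a \<bullet> Y = 1" "X \<noteq> Y" for X Y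
    using height_closure_pos[of "Y - X"] that by (auto simp: inner_diff_right)
  \<comment> \<open>With constant 1 the difference would be a nonzero vector of height zero in the
    closed cone.\<close>
  have gt1: "1 < \<alpha>" if "\<alpha> *\<^sub>R Y - X \<in> closure C" "a \<bullet> X = 1" "a \<bullet> Y = 1" "X \<noteq> Y" for \<alpha> X Y
  proof -
    have "1 \<le> \<alpha>" using birkhoff_height[OF that(1)] that by simp
    moreover have "\<alpha> \<noteq> 1" using that(1) Y_X[OF that(2-4)] by auto
    ultimately show ?thesis by simp
  qed
  have sc: "c *\<^sub>R v \<in> closure C \<longleftrightarrow> v \<in> closure C" if "0 < c" for c v
    using closure_scale[of c v] closure_scale[of "inverse c" "c *\<^sub>R v"] that by auto
  have al: "\<alpha> *\<^sub>R Y - X \<in> closure C \<longleftrightarrow> q / (q - 1) \<le> \<alpha>" if "1 < \<alpha>" for \<alpha>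
  proof -
    have "\<alpha> *\<^sub>R Y - X = (\<alpha> - 1) *\<^sub>R (X + (\<alpha> / (\<alpha> - 1)) *\<^sub>R (Y - X))"
      using that by (simp add: scaleR_add_right) (simp add: algebra_simps)
    then have "\<alpha> *\<^sub>R Y - X \<in> closure C \<longleftrightarrow> p \<le> \<alpha> / (\<alpha> - 1) \<and> \<alpha> / (\<alpha> - 1) \<le> q"
      using sc[of "\<alpha> - 1"] that chord by simp
    moreover have "p \<le> \<alpha> / (\<alpha> - 1)"
    proof -
      have "0 \<le> \<alpha> / (\<alpha> - 1)" using that by simp
      then show ?thesis using pq(1) by linarith
    qed
    moreover have "\<alpha> / (\<alpha> - 1) \<le> q \<longleftrightarrow> q / (q - 1) \<le> \<alpha>" using that pq by (simp add: field_simps)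
    ultimately show ?thesis by blast
  qed
  have be: "\<beta> *\<^sub>R X - Y \<in> closure C \<longleftrightarrow> (1 - p) / (- p) \<le> \<beta>" if "1 < \<beta>" for \<beta>
  proof -
    have "\<beta> *\<^sub>R X - Y = (\<beta> - 1) *\<^sub>R (X + (- 1 / (\<beta> - 1)) *\<^sub>R (Y - X))"
      using that by (simp add: scaleR_add_right) (simp add: algebra_simps)
    then have "\<beta> *\<^sub>R X - Y \<in> closure C \<longleftrightarrow> p \<le> - 1 / (\<beta> - 1) \<and> - 1 / (\<beta> - 1) \<le> q"
      using sc[of "\<beta> - 1"] that chord[of "- 1 / (\<beta> - 1)"] by simp
    moreover have "- 1 / (\<beta> - 1) \<le> q"
    proof -
      have "- 1 / (\<beta> - 1) \<le> 0" using that by simp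
      then show ?thesis using pq(2) by linarith
    qed
    moreover have "p \<le> - 1 / (\<beta> - 1) \<longleftrightarrow> (1 - p) / (- p) \<le> \<beta>" using that pq by (simp add: field_simps)
    ultimately show ?thesis by blast
  qed
  have q1: "1 < q / (q - 1)" and p1: "1 < (1 - p) / (- p)" using pq by (auto simp: field_simps)
  have prod: "q / (q - 1) * ((1 - p) / (- p)) = ((1 - p) * q) / ((- p) * (q - 1))" by (simp add: mult.commute)
  show ?thesis
  proof
    assume "birkhoff D X Y"
    then obtain \<alpha> \<beta> where ab: "\<alpha> * \<beta> \<le> exp (2 * D)"
      "\<alpha> *\<^sub>R Y - X \<in> closure C" "\<beta> *\<^sub>R X - Y \<in> closure C" unfolding birkhoff_def by blast
    have g: "1 < \<alpha>" "1 < \<beta>" using gt1[OF ab(2)] gt1[OF ab(3)] X Y assms(5) by auto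
    have "q / (q - 1) * ((1 - p) / (- p)) \<le> \<alpha> * \<beta>"
      using al[OF g(1)] be[OF g(2)] ab g p1 q1 by (intro mult_mono) auto
    then show "((1 - p) * q) / ((- p) * (q - 1)) \<le> exp (2 * D)" using ab(1) prod by linarith
  next
    assume "((1 - p) * q) / ((- p) * (q - 1)) \<le> exp (2 * D)"
    then show "birkhoff D X Y" unfolding birkhoff_def
      using al[OF q1] be[OF p1] q1 p1 prod
      by (intro exI[of _ "q / (q - 1)"] exI[of _ "(1 - p) / (- p)"]) auto
  qed
qed

end

section \<open>Projective space and the cone over a domain\<close>

lemma pclass_cases:
  fixes p :: "'d::finite rproj"
  obtains v where "v \<noteq> 0" "p = pclass v"
proof -
  have L: "subspace (line_of p)" "dim (line_of p) = 1" using line_of[of p] by auto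
  obtain B where B: "B \<subseteq> line_of p" "independent B" "line_of p \<subseteq> span B" "card B = dim (line_of p)"
    using basis_exists by blast
  then obtain v where v: "B = {v}" using L(2) by (metis card_1_singletonE)
  then have "v \<noteq> 0" using B(2) by auto
  moreover have "line_of p = span {v}" using B(1,3) L(1) v by (metis span_minimal subset_antisym)
  then have "p = pclass v" unfolding pclass_def using line_of_inverse[of p] by simp
  ultimately show ?thesis by (rule that)
qed

lemma pclass_scaleR: assumes "c \<noteq> 0" shows "pclass (c *\<^sub>R v) = pclass v"
proof -
  have "span {c *\<^sub>R v} = span {v}"
    using assms span_image_scale[of "{v}" "\<lambda>_. c"] by simp
  then show ?thesis by (simp add: pclass_def)
qed

lemma pclass_eqD:
  assumes "v \<noteq> 0" "w \<noteq> 0" "pclass v = pclass w"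
  obtains c where "c \<noteq> 0" "w = c *\<^sub>R v"
proof -
  have "w \<in> span {v}" using line_of_pclass[OF assms(1)] line_of_pclass[OF assms(2)] assms(3)
    by (metis span_base singletonI)
  then obtain c where "w = c *\<^sub>R v" by (auto simp: span_singleton)
  then show ?thesis using that assms(2) by (cases "c = 0") auto
qed

lemma affine_chart_pclass: assumes "v \<noteq> 0" shows "pclass v \<in> affine_chart a \<longleftrightarrow> a \<bullet> v \<noteq> 0"
  unfolding affine_chart_def mem_Collect_eq line_of_pclass[OF assms] span_singleton
  by (auto intro: exI[of _ 1])

lemma chart_coord_pclass: assumes "a \<bullet> v \<noteq> 0" shows "chart_coord a (pclass v) = v /\<^sub>R (a \<bullet> v)"
proof -
  have "v \<noteq> 0" using assms by auto
  then show ?thesis unfolding chart_coord_def line_of_pclass[OF \<open>v \<noteq> 0\<close>] span_singleton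
    using assms by (intro the_equality) (auto simp: field_simps)
qed

lemma chart_coord:
  assumes "p \<in> affine_chart a"
  shows inner_chart_coord: "a \<bullet> chart_coord a p = 1" and pclass_chart_coord: "pclass (chart_coord a p) = p"
proof -
  obtain v where v: "v \<noteq> 0" "p = pclass v" by (rule pclass_cases)
  then have av: "a \<bullet> v \<noteq> 0" using assms affine_chart_pclass by blast
  then show "a \<bullet> chart_coord a p = 1" "pclass (chart_coord a p) = p"
    unfolding v(2) chart_coord_pclass[OF av] by (simp_all add: pclass_scaleR)
qed

text \<open>The preimage of the image is the union of all nonzero multiples of
  \<open>U\<close>.\<close>

lemma open_pclass_image:
  assumes "open U" "0 \<notin> U" shows "open (pclass ` U)"
proof -
  have "{v. v \<noteq> 0 \<and> pclass v \<in> pclass ` U} = (\<Union>c\<in>-{0}. (\<lambda>v. c *\<^sub>R v) ` U)" (is "?L = ?R")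
  proof
    show "?L \<subseteq> ?R"
    proof
      fix v assume "v \<in> ?L"
      then obtain u where u: "v \<noteq> 0" "u \<in> U" "pclass u = pclass v" by auto
      then obtain c where "c \<noteq> 0" "v = c *\<^sub>R u" using assms(2) pclass_eqD[of u v] by metis
      then show "v \<in> ?R" using u(2) by auto
    qed
    show "?R \<subseteq> ?L" using assms(2) by (auto simp: pclass_scaleR)
  qed
  moreover have "open ?R" using assms(1) by (intro open_UN ballI open_scaling) auto
  ultimately show ?thesis by (simp add: open_rproj_def)
qed

lemma continuous_on_chart_coord: "continuous_on (affine_chart a) (chart_coord a)"
proof -
  have op: "open {v. a \<bullet> v \<noteq> 0}" by (intro open_Collect_neq continuous_intros)
  have eq: "{v. v \<noteq> 0 \<and> pclass v \<in> affine_chart a} = {v. a \<bullet> v \<noteq> 0}"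
  proof (rule set_eqI)
    show "v \<in> {v. v \<noteq> 0 \<and> pclass v \<in> affine_chart a} \<longleftrightarrow> v \<in> {v. a \<bullet> v \<noteq> 0}" for v
      using affine_chart_pclass[of v a] by (cases "v = 0") auto
  qed
  then have "open (affine_chart a)" using op by (simp add: open_rproj_def)
  moreover have "open (chart_coord a -` B \<inter> affine_chart a)" if "open B" for B
  proof -
    have "{v. v \<noteq> 0 \<and> pclass v \<in> chart_coord a -` B \<inter> affine_chart a} =
        {v. a \<bullet> v \<noteq> 0} \<inter> (\<lambda>v. v /\<^sub>R (a \<bullet> v)) -` B"
    proof (rule set_eqI)
      fix v
      show "v \<in> {v. v \<noteq> 0 \<and> pclass v \<in> chart_coord a -` B \<inter> affine_chart a} \<longleftrightarrow>
          v \<in> {v. a \<bullet> v \<noteq> 0} \<inter> (\<lambda>v. v /\<^sub>R (a \<bullet> v)) -` B"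
      proof (cases "a \<bullet> v = 0")
        case True
        then show ?thesis using affine_chart_pclass[of v a] by auto
      next
        case False
        then have "v \<noteq> 0" by auto
        then show ?thesis using False by (simp add: affine_chart_pclass chart_coord_pclass)
      qed
    qed
    moreover have "open ({v. a \<bullet> v \<noteq> 0} \<inter> (\<lambda>v. v /\<^sub>R (a \<bullet> v)) -` B)"
    proof (rule continuous_open_preimage[OF _ op that])
      show "continuous_on {v. a \<bullet> v \<noteq> 0} (\<lambda>v. v /\<^sub>R (a \<bullet> v))"
        by (intro continuous_intros) auto
    qed
    ultimately show ?thesis by (simp add: open_rproj_def)
  qed
  ultimately show ?thesis by (simp add: continuous_on_open_vimage)
qed

section \<open>The cone over a domain\<close>

text \<open>The vectors over a domain in the chart form two opposite cones; the height selects one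
  of them.\<close>

definition lift_cone :: "'d::finite rproj set \<Rightarrow> real^'d \<Rightarrow> (real^'d) set" where
  "lift_cone \<Omega> a = {v. 0 < a \<bullet> v \<and> pclass v \<in> \<Omega>}"

locale charted_domain =
  fixes \<Omega> :: "'d::finite rproj set" and a :: "real^'d"
  assumes open_domain: "open \<Omega>" and domain_nonempty: "\<Omega> \<noteq> {}" and adapted: "adapted_chart \<Omega> a"
    and coord_eq: "coord \<Omega> = chart_coord a"
begin

abbreviation cone where "cone \<equiv> lift_cone \<Omega> a"

lemma closure_chart: "p \<in> closure \<Omega> \<Longrightarrow> p \<in> affine_chart a"
  using adapted by (auto simp: adapted_chart_def)

lemma coord_props:
  assumes "p \<in> closure \<Omega>"
  shows inner_coord: "a \<bullet> coord \<Omega> p = 1" and pclass_coord: "pclass (coord \<Omega> p) = p"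
  unfolding coord_eq using chart_coord[OF closure_chart[OF assms]] by auto

lemma inj_on_coord: "inj_on (coord \<Omega>) (closure \<Omega>)"
  by (rule inj_on_inverseI[of _ pclass]) (rule pclass_coord)

lemma coord_pclass: "a \<bullet> v = 1 \<Longrightarrow> coord \<Omega> (pclass v) = v"
  by (simp add: coord_eq chart_coord_pclass)

text \<open>Closures correspond because \<open>pclass\<close> is continuous and open on nonzero
  vectors: one direction pulls neighbourhoods back, the other pushes them forward.\<close>

lemma mem_closure_lift_cone:
  assumes v: "0 < a \<bullet> v" shows "v \<in> closure cone \<longleftrightarrow> pclass v \<in> closure \<Omega>"
proof
  assume "v \<in> closure cone"
  show "pclass v \<in> closure \<Omega>"
  proof (rule closure_iff_nhds_not_empty[THEN iffD2], intro allI impI)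
    fix S U assume U: "U \<subseteq> S" "open U" "pclass v \<in> U"
    have "open {u. u \<noteq> 0 \<and> pclass u \<in> U}" using U(2) by (simp add: open_rproj_def)
    moreover have "v \<in> {u. u \<noteq> 0 \<and> pclass u \<in> U}" using v U(3) by auto
    ultimately have "cone \<inter> {u. u \<noteq> 0 \<and> pclass u \<in> U} \<noteq> {}"
      using \<open>v \<in> closure cone\<close> open_Int_closure_eq_empty by blast
    then show "\<Omega> \<inter> S \<noteq> {}" using U(1) by (auto simp: lift_cone_def)
  qed
next
  assume p: "pclass v \<in> closure \<Omega>"
  show "v \<in> closure cone"
  proof (rule closure_iff_nhds_not_empty[THEN iffD2], intro allI impI)
    fix S U assume U: "U \<subseteq> S" "open U" "v \<in> U"
    define U' where "U' = U \<inter> {u. 0 < a \<bullet> u}"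
    have "open U'" unfolding U'_def by (intro open_Int U open_Collect_less continuous_intros)
    then have "open (pclass ` U')" by (rule open_pclass_image) (auto simp: U'_def)
    moreover have "pclass v \<in> pclass ` U'" using v U(3) by (auto simp: U'_def)
    ultimately obtain u where "u \<in> U'" "pclass u \<in> \<Omega>"
      using p open_Int_closure_eq_empty[of "pclass ` U'" \<Omega>] by blast
    then show "cone \<inter> S \<noteq> {}" using U(1) by (auto simp: lift_cone_def U'_def)
  qed
qed

lemma domain_subset_closure: "p \<in> \<Omega> \<Longrightarrow> p \<in> closure \<Omega>"
  using closure_subset by blast

lemma coord_in_cone: assumes "p \<in> closure \<Omega>" shows "coord \<Omega> p \<in> cone \<longleftrightarrow> p \<in> \<Omega>"
  using coord_props[OF assms] by (simp add: lift_cone_def)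

lemma coord_in_closure_cone: "p \<in> closure \<Omega> \<Longrightarrow> coord \<Omega> p \<in> closure cone"
  using coord_props mem_closure_lift_cone[of "coord \<Omega> p"] by auto

lemma mem_lift_cone_iff: "v \<in> cone \<longleftrightarrow> 0 < a \<bullet> v \<and> v /\<^sub>R (a \<bullet> v) \<in> chart_coord a ` \<Omega>"
proof -
  have "pclass v \<in> \<Omega> \<longleftrightarrow> v /\<^sub>R (a \<bullet> v) \<in> chart_coord a ` \<Omega>" if v: "0 < a \<bullet> v"
  proof
    assume "pclass v \<in> \<Omega>"
    then show "v /\<^sub>R (a \<bullet> v) \<in> chart_coord a ` \<Omega>" using chart_coord_pclass[of a v] v by (metis imageI less_irrefl)
  next
    assume "v /\<^sub>R (a \<bullet> v) \<in> chart_coord a ` \<Omega>"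
    then obtain p where p: "p \<in> \<Omega>" "v /\<^sub>R (a \<bullet> v) = chart_coord a p" by blast
    then have "pclass (v /\<^sub>R (a \<bullet> v)) = p" using pclass_chart_coord closure_chart domain_subset_closure by metis
    then show "pclass v \<in> \<Omega>" using p(1) pclass_scaleR[of "inverse (a \<bullet> v)" v] v by simp
  qed
  then show ?thesis by (auto simp: lift_cone_def)
qed

sublocale sharp_cone cone a
proof
  have "cone = {v. v \<noteq> 0 \<and> pclass v \<in> \<Omega>} \<inter> {v. 0 < a \<bullet> v}" by (auto simp: lift_cone_def)
  moreover have "open ({v. v \<noteq> 0 \<and> pclass v \<in> \<Omega>} \<inter> {v. 0 < a \<bullet> v})"
    using open_domain unfolding open_rproj_def by (intro open_Int open_Collect_less continuous_intros)
  ultimately show "open cone" by (rule ssubst)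
  show "cone \<noteq> {}" using domain_nonempty coord_in_cone domain_subset_closure by blast
  show "c *\<^sub>R v \<in> cone" if "0 < c" "v \<in> cone" for c v
    using that by (simp add: lift_cone_def pclass_scaleR)
  show "0 < a \<bullet> v" if "v \<in> cone" for v using that by (simp add: lift_cone_def)
  show "convex cone"
  proof (rule convexI)
    fix u v s t assume uv: "u \<in> cone" "v \<in> cone" "0 \<le> s" "0 \<le> t" "s + t = (1::real)"
    define w where "w = s *\<^sub>R u + t *\<^sub>R v"
    have pos: "0 < a \<bullet> u" "0 < a \<bullet> v" using uv by (auto simp: lift_cone_def)
    have w: "a \<bullet> w = s * (a \<bullet> u) + t * (a \<bullet> v)" by (simp add: w_def inner_add_right)
    have "0 < a \<bullet> w"
    proof (cases "s = 0")
      case False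
      then have "0 < s * (a \<bullet> u)" "0 \<le> t * (a \<bullet> v)" using uv pos by auto
      then show ?thesis using w by linarith
    qed (use uv pos w in simp)
    \<comment> \<open>The normalisation of \<open>w\<close> is a convex combination of those of
      \<open>u\<close> and \<open>v\<close>, with the weights scaled by the heights.\<close>
    moreover have "(s * (a \<bullet> u) / (a \<bullet> w)) *\<^sub>R (u /\<^sub>R (a \<bullet> u)) + (t * (a \<bullet> v) / (a \<bullet> w)) *\<^sub>R (v /\<^sub>R (a \<bullet> v))
        \<in> chart_coord a ` \<Omega>"
      using uv mem_lift_cone_iff adapted pos calculation
      by (intro convexD) (auto simp: adapted_chart_def w add_divide_distrib[symmetric])
    moreover have "(s * (a \<bullet> u) / (a \<bullet> w)) *\<^sub>R (u /\<^sub>R (a \<bullet> u)) + (t * (a \<bullet> v) / (a \<bullet> w)) *\<^sub>R (v /\<^sub>R (a \<bullet> v))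
        = w /\<^sub>R (a \<bullet> w)"
    proof -
      have "w /\<^sub>R c = (s / c) *\<^sub>R u + (t / c) *\<^sub>R v" for c
        by (simp add: w_def scaleR_add_right divide_inverse mult.commute)
      moreover have "(s * (a \<bullet> u) / (a \<bullet> w)) *\<^sub>R (u /\<^sub>R (a \<bullet> u)) = (s / (a \<bullet> w)) *\<^sub>R u"
        "(t * (a \<bullet> v) / (a \<bullet> w)) *\<^sub>R (v /\<^sub>R (a \<bullet> v)) = (t / (a \<bullet> w)) *\<^sub>R v"
        using pos by simp_all
      ultimately show ?thesis by (simp only:)
    qed
    ultimately show "s *\<^sub>R u + t *\<^sub>R v \<in> cone" unfolding w_def[symmetric] mem_lift_cone_iff by simp
  qed
  obtain B where B: "\<And>v. v \<in> chart_coord a ` \<Omega> \<Longrightarrow> norm v \<le> B"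
    using adapted unfolding adapted_chart_def bounded_iff by blast
  have "norm v \<le> B * (a \<bullet> v)" if "v \<in> cone" for v
  proof -
    have "norm (v /\<^sub>R (a \<bullet> v)) \<le> B" "0 < a \<bullet> v" using that mem_lift_cone_iff B by blast+
    then show ?thesis by (simp add: field_simps)
  qed
  then show "\<exists>B. \<forall>v\<in>cone. norm v \<le> B * (a \<bullet> v)" by blast
qed

text \<open>At height 1 nonnegative coefficients automatically sum to 1, so the slice of the conic
  hull is the convex hull in the chart. It competes in the intersection defining \<open>CH\<close>,
  and any competitor contains its convex combinations.\<close>

lemma mem_CH_iff:
  assumes "finite I" "v ` I \<subseteq> closure \<Omega>"
  shows "p \<in> CH \<Omega> (v ` I) \<longleftrightarrow> p \<in> closure \<Omega> \<and> coord \<Omega> p \<in> conic_hull (\<lambda>l. coord \<Omega> (v l)) I"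
proof -
  let ?V = "\<lambda>l. coord \<Omega> (v l)"
  define H where "H = {p \<in> closure \<Omega>. coord \<Omega> p \<in> conic_hull ?V I}"
  have "coord \<Omega> ` H = conic_hull ?V I \<inter> {u. a \<bullet> u = 1}"
  proof
    show "coord \<Omega> ` H \<subseteq> conic_hull ?V I \<inter> {u. a \<bullet> u = 1}" by (auto simp: H_def inner_coord)
    show "conic_hull ?V I \<inter> {u. a \<bullet> u = 1} \<subseteq> coord \<Omega> ` H"
    proof
      fix u assume u: "u \<in> conic_hull ?V I \<inter> {u. a \<bullet> u = 1}"
      then have "u \<in> closure cone"
        using conic_hull_closure[OF assms(1), of ?V] coord_in_closure_cone assms(2) by blast
      then have "pclass u \<in> H" using u by (simp add: H_def mem_closure_lift_cone[symmetric] coord_pclass)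
      then show "u \<in> coord \<Omega> ` H" using u coord_pclass by (intro image_eqI[of _ _ "pclass u"]) auto
    qed
  qed
  moreover have "convex (conic_hull ?V I)"
    by (intro convexI conic_hull_add conic_hull_scale)
  moreover have "convex {u. a \<bullet> u = 1}" by (rule convex_hyperplane)
  ultimately have "convex (coord \<Omega> ` H)" by (simp add: convex_Int)
  moreover have "v ` I \<subseteq> H" using assms conic_hull_inc[OF assms(1), of _ ?V] by (auto simp: H_def)
  moreover have "H \<subseteq> closure \<Omega>" by (auto simp: H_def)
  ultimately have "CH \<Omega> (v ` I) \<subseteq> H" unfolding CH_def by (intro Inter_lower CollectI conjI)
  moreover have "p \<in> C" if p: "p \<in> H" and C: "C \<subseteq> closure \<Omega>" "convex (coord \<Omega> ` C)" "v ` I \<subseteq> C" for p C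
  proof -
    obtain \<mu> where \<mu>: "coord \<Omega> p = (\<Sum>l\<in>I. \<mu> l *\<^sub>R ?V l)" "\<forall>l\<in>I. 0 \<le> \<mu> l"
      using p by (auto simp: H_def conic_hull_def)
    have "(\<Sum>l\<in>I. \<mu> l) = (\<Sum>l\<in>I. \<mu> l * (a \<bullet> ?V l))"
      using assms(2) by (intro sum.cong) (auto simp: inner_coord)
    also have "\<dots> = a \<bullet> coord \<Omega> p" unfolding \<mu>(1) by (simp add: inner_sum_right)
    also have "\<dots> = 1" using p by (simp add: H_def inner_coord)
    finally have "coord \<Omega> p \<in> coord \<Omega> ` C"
      unfolding \<mu>(1) using \<mu>(2) C by (intro convex_sum assms) auto
    then obtain q where q: "q \<in> C" "coord \<Omega> p = coord \<Omega> q" by blast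
    then have "p = q" using inj_onD[OF inj_on_coord q(2)] C(1) p by (auto simp: H_def)
    then show "p \<in> C" using q(1) by simp
  qed
  then have "H \<subseteq> CH \<Omega> (v ` I)" unfolding CH_def by (intro Inter_greatest subsetI) auto
  ultimately show ?thesis by (auto simp: H_def)
qed

section \<open>Automorphisms acting on the cone\<close>

text \<open>A matrix representing \<open>g\<close> sends the cone to itself or to its negative: the
  height of the image is nonzero on the connected cone and so has constant sign. Multiplying by a
  scalar \<open>s\<close> of that sign gives the lift.\<close>

lemma Aut_linear_lift:
  assumes "g \<in> Aut \<Omega>"
  obtains A where "linear A" "inj A" "A ` cone = cone" "\<And>v. v \<noteq> 0 \<Longrightarrow> g (pclass v) = pclass (A v)"
proof -
  obtain M where M: "g = proj_map M" "invertible M" and g: "g ` \<Omega> = \<Omega>"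
    using assms by (auto simp: Aut_def PGL_def)
  have gM: "g (pclass v) = pclass (M *v v)" if "v \<noteq> 0" for v
    unfolding M(1) proj_map_def line_of_pclass[OF that]
    using linear_span_image[OF matrix_vector_mul_linear, of M "{v}"] by (simp add: pclass_def)
  have inj: "inj ((*v) M)" using M(2) by (simp add: inj_matrix_vector_mult)
  have nz: "M *v v \<noteq> 0" if "v \<noteq> 0" for v using inj that by (metis injD matrix_vector_mult_0_right)
  have cone_nz: "v \<noteq> 0" if "v \<in> cone" for v using that by (auto simp: lift_cone_def)
  have dom: "pclass (M *v v) \<in> \<Omega>" if "v \<in> cone" for v
  proof -
    have "g (pclass v) \<in> g ` \<Omega>" using that by (intro imageI) (simp add: lift_cone_def)
    then show ?thesis using g gM[OF cone_nz[OF that]] by simp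
  qed
  have ne: "a \<bullet> (M *v v) \<noteq> 0" if "v \<in> cone" for v
    using affine_chart_pclass[OF nz[OF cone_nz[OF that]]] closure_chart domain_subset_closure dom[OF that] by blast
  define J where "J = (\<lambda>v. a \<bullet> (M *v v)) ` cone"
  have "connected J" unfolding J_def
    by (intro connected_continuous_image continuous_intros convex_connected convex_cone
      linear_continuous_on matrix_vector_mul_bounded_linear)
  then have int: "is_interval J" by (simp add: is_interval_connected_1)
  have "\<exists>s::real. s \<noteq> 0 \<and> (\<forall>x\<in>J. 0 < s * x)"
  proof (rule ccontr)
    assume *: "\<not> ?thesis"
    have "\<not> (\<forall>x\<in>J. 0 < 1 * x)" "\<not> (\<forall>x\<in>J. 0 < (-1) * x)" using * by (metis zero_neq_one neg_equal_0_iff_equal)+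
    then obtain x y where xy: "x \<in> J" "x \<le> 0" "y \<in> J" "0 \<le> y" by (auto simp: not_less)
    then have "0 \<in> J" using int by (meson is_interval_1)
    then show False using ne by (auto simp: J_def)
  qed
  then obtain s :: real where s: "s \<noteq> 0" "\<And>x. x \<in> J \<Longrightarrow> 0 < s * x" by blast
  define A where "A v = s *\<^sub>R (M *v v)" for v
  have lin: "linear A" unfolding A_def
    by (intro linear_compose_scale_right matrix_vector_mul_linear)
  have injA: "inj A" using inj s(1) by (auto simp: inj_def A_def)
  have gA: "g (pclass v) = pclass (A v)" if "v \<noteq> 0" for v
    using gM[OF that] s(1) by (simp add: A_def pclass_scaleR)
  have sub: "A v \<in> cone" if "v \<in> cone" for v
    using that dom[OF that] s by (simp add: A_def lift_cone_def pclass_scaleR J_def)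
  have "w \<in> A ` cone" if w: "w \<in> cone" for w
  proof -
    have "pclass w \<in> g ` \<Omega>" using w g by (simp add: lift_cone_def)
    then obtain p where p: "p \<in> \<Omega>" "pclass w = g p" by blast
    define u where "u = coord \<Omega> p"
    have u: "u \<in> cone" "p = pclass u"
      using p(1) domain_subset_closure coord_in_cone pclass_coord by (auto simp: u_def)
    have Au: "A u \<in> cone" by (rule sub[OF u(1)])
    have "pclass (A u) = pclass w" using p(2) u gA cone_nz by simp
    then obtain c where c: "c \<noteq> 0" "w = c *\<^sub>R A u" using pclass_eqD cone_nz[OF w] cone_nz[OF Au] by metis
    then have "0 < c * (a \<bullet> A u)" using w by (simp add: lift_cone_def)
    then have "0 < c" using Au by (simp add: lift_cone_def zero_less_mult_iff)
    then show ?thesis using c(2) linear_cmul[OF lin] scale_cone[OF _ u(1)] by (metis imageI)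
  qed
  then have "A ` cone = cone" using sub by blast
  then show ?thesis using that lin injA gA by blast
qed

text \<open>If \<open>g\<close> carries a point of \<open>K\<close> to the class of
  \<open>X\<close>, its lift sends the normalised point \<open>u\<close> to a positive multiple of
  \<open>X\<close>. The inverse lift, rescaled by that factor, preserves the cone and sends
  \<open>X\<close> exactly to \<open>u\<close>.\<close>

lemma cocompact_cone:
  assumes "quasi_homogeneous \<Omega>"
  obtains K0 where "compact K0" "K0 \<subseteq> cone"
    "\<And>X. X \<in> cone \<Longrightarrow> \<exists>A. linear A \<and> inj A \<and> A ` cone = cone \<and> A X \<in> K0"
proof -
  obtain K where K: "compact K" "K \<subseteq> \<Omega>" "(\<Union>g\<in>Aut \<Omega>. g ` K) = \<Omega>"
    using assms by (auto simp: quasi_homogeneous_def)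
  define K0 where "K0 = coord \<Omega> ` K"
  have "K \<subseteq> affine_chart a" using K(2) closure_chart domain_subset_closure by blast
  then have "compact K0" unfolding K0_def coord_eq
    using K(1) continuous_on_subset[OF continuous_on_chart_coord] compact_continuous_image by blast
  moreover have "K0 \<subseteq> cone" using K(2) domain_subset_closure coord_in_cone by (auto simp: K0_def)
  moreover have "\<exists>A. linear A \<and> inj A \<and> A ` cone = cone \<and> A X \<in> K0" if X: "X \<in> cone" for X
  proof -
    have "pclass X \<in> (\<Union>g\<in>Aut \<Omega>. g ` K)" using X K(3) by (simp add: lift_cone_def)
    then obtain g k where g: "g \<in> Aut \<Omega>" "k \<in> K" "pclass X = g k" by blast
    obtain A where A: "linear A" "inj A" "A ` cone = cone" "\<And>v. v \<noteq> 0 \<Longrightarrow> g (pclass v) = pclass (A v)"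
      by (rule Aut_linear_lift[OF g(1)]) blast
    define u where "u = coord \<Omega> k"
    have u: "u \<in> cone" "k = pclass u" "u \<in> K0"
      using g(2) K(2) domain_subset_closure coord_in_cone pclass_coord by (auto simp: u_def K0_def)
    have Au: "A u \<in> cone" using u(1) A(3) by blast
    have nz: "X \<noteq> 0" "u \<noteq> 0" "A u \<noteq> 0" using X u(1) Au by (auto simp: lift_cone_def)
    have "pclass (A u) = pclass X" using g(3) u(2) A(4)[OF nz(2)] by simp
    then obtain c where c: "c \<noteq> 0" "X = c *\<^sub>R A u" using pclass_eqD nz by metis
    then have "0 < c * (a \<bullet> A u)" using X by (simp add: lift_cone_def)
    then have c0: "0 < c" using Au by (simp add: lift_cone_def zero_less_mult_iff)
    define B where "B v = inverse c *\<^sub>R inv A v" for v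
    have "linear (inv A)" by (rule inj_linear_imp_inv_linear[OF A(1,2)])
    then have "linear B" unfolding B_def by (intro linear_compose_scale_right)
    moreover have "inj B"
    proof -
      have "surj A" using A(1,2) by (rule linear_inj_imp_surj)
      then have "inj (inv A)" by (rule surj_imp_inj_inv)
      then show ?thesis using c0 by (simp add: inj_def B_def)
    qed
    moreover have "B ` cone = cone"
    proof -
      have "inv A ` (A ` cone) = cone" by (rule image_inv_f_f[OF A(2)])
      then have 1: "inv A ` cone = cone" unfolding A(3) .
      have "(\<lambda>v. inverse c *\<^sub>R v) ` cone = cone"
      proof
        show "(\<lambda>v. inverse c *\<^sub>R v) ` cone \<subseteq> cone" using c0 scale_cone by auto
        show "cone \<subseteq> (\<lambda>v. inverse c *\<^sub>R v) ` cone"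
        proof
          fix v assume "v \<in> cone"
          then have "c *\<^sub>R v \<in> cone" using c0 scale_cone by blast
          moreover have "v = inverse c *\<^sub>R (c *\<^sub>R v)" using c0 by simp
          ultimately show "v \<in> (\<lambda>v. inverse c *\<^sub>R v) ` cone" by blast
        qed
      qed
      then show ?thesis using 1 unfolding B_def by (metis image_image)
    qed
    moreover have "B X = u"
      unfolding B_def c(2) using c0 by (simp add: linear_cmul[OF \<open>linear (inv A)\<close>] inv_f_f[OF A(2)])
    ultimately show ?thesis using u(3) by metis
  qed
  ultimately show ?thesis by (rule that)
qed

section \<open>The Hilbert metric\<close>

text \<open>The chord endpoints are the points with parameters \<open>p\<close> and
  \<open>q\<close>. Distances on the line are parameter differences times the length of
  \<open>d\<close>, which cancels in the cross-ratio.\<close>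

lemma hilbert_dist_chord:
  assumes xy: "x \<in> \<Omega>" "y \<in> \<Omega>" "x \<noteq> y" and X: "X = coord \<Omega> x" and Y: "Y = coord \<Omega> y"
    and pq: "p < 0" "1 < q" "X + p *\<^sub>R (Y - X) \<notin> cone" "X + q *\<^sub>R (Y - X) \<notin> cone"
    and chord: "\<And>t. X + t *\<^sub>R (Y - X) \<in> closure cone \<longleftrightarrow> p \<le> t \<and> t \<le> q"
  shows "hilbert_dist \<Omega> x y = 1/2 * ln (((1 - p) * q) / ((- p) * (q - 1)))"
proof -
  have cl: "x \<in> closure \<Omega>" "y \<in> closure \<Omega>" using xy domain_subset_closure by auto
  have XY: "a \<bullet> X = 1" "a \<bullet> Y = 1" "pclass X = x" "pclass Y = y"
    using coord_props cl by (auto simp: X Y)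
  define d where "d = Y - X"
  have d: "d \<noteq> 0" using XY xy(3) by (auto simp: d_def)
  define f where "f t = X + t *\<^sub>R d" for t
  have af: "a \<bullet> f t = 1" for t by (simp add: f_def d_def inner_add_right inner_diff_right XY)
  have f01: "f 0 = X" "f 1 = Y" by (auto simp: f_def d_def)
  have injf: "f s = f t \<longleftrightarrow> s = t" for s t using d by (simp add: f_def)
  have chordf: "f t \<in> closure cone \<longleftrightarrow> p \<le> t \<and> t \<le> q" for t using chord by (simp add: f_def d_def)
  define P where "P = pclass (f p)"
  define Q where "Q = pclass (f q)"
  have cf: "coord \<Omega> (pclass (f t)) = f t" for t using coord_pclass[OF af] .
  have PQ: "P \<in> ideal_boundary \<Omega>" "Q \<in> ideal_boundary \<Omega>"
  proof -
    have "pclass (f t) \<in> closure \<Omega>" if "p \<le> t" "t \<le> q" for t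
      using mem_closure_lift_cone[of "f t"] chordf[of t] that af by simp
    moreover have "pclass (f p) \<notin> \<Omega>" "pclass (f q) \<notin> \<Omega>"
      using pq(3,4) af by (auto simp: lift_cone_def f_def d_def)
    ultimately show "P \<in> ideal_boundary \<Omega>" "Q \<in> ideal_boundary \<Omega>"
      using pq(1,2) by (auto simp: ideal_boundary_def P_def Q_def)
  qed
  have cseg: "closed_segment (f s) (f t) = f ` closed_segment s t" for s t
    unfolding f_def by (rule closed_segment_on_line)
  have oseg: "open_segment (f s) (f t) = f ` open_segment s t" for s t
    unfolding f_def by (rule open_segment_on_line[OF d])
  \<comment> \<open>The projective line is the span of \<open>X\<close> and \<open>Y\<close>, whose
    slice at height 1 is the affine line through them.\<close>
  have mem_line: "z \<in> proj_line x y \<longleftrightarrow> coord \<Omega> z \<in> range f" if z: "z \<in> closure \<Omega>" for z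
  proof -
    define w where "w = coord \<Omega> z"
    have w: "a \<bullet> w = 1" "pclass w = z" using coord_props[OF z] by (auto simp: w_def)
    have nz: "w \<noteq> 0" "X \<noteq> 0" "Y \<noteq> 0" using w(1) XY by auto
    have lines: "line_of z = span {w}" "line_of x = span {X}" "line_of y = span {Y}"
      using line_of_pclass nz w XY by metis+
    have "span (span {X} \<union> span {Y}) = span {X, Y}"
    proof (rule subset_antisym)
      have "span {X} \<union> span {Y} \<subseteq> span {X, Y}" by (intro Un_least span_mono) auto
      then show "span (span {X} \<union> span {Y}) \<subseteq> span {X, Y}" by (rule span_minimal) (rule subspace_span)
      have "{X, Y} \<subseteq> span {X} \<union> span {Y}" using span_base by blast
      then show "span {X, Y} \<subseteq> span (span {X} \<union> span {Y})" by (rule span_mono)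
    qed
    then have "z \<in> proj_line x y \<longleftrightarrow> span {w} \<subseteq> span {X, Y}"
      unfolding proj_line_def mem_Collect_eq lines by (rule arg_cong)
    also have "\<dots> \<longleftrightarrow> w \<in> span {X, Y}"
      using span_base[of w "{w}"] span_minimal[OF _ subspace_span, of "{w}" "{X, Y}"] by blast
    also have "\<dots> \<longleftrightarrow> w \<in> range f"
    proof
      assume "w \<in> span {X, Y}"
      then obtain k l where kl: "w - k *\<^sub>R X = l *\<^sub>R Y" by (auto simp: span_breakdown_eq span_singleton)
      then have w': "w = k *\<^sub>R X + l *\<^sub>R Y" by (simp add: algebra_simps)
      then have "k + l = 1" using w(1) XY by (simp add: inner_add_right)
      then have k: "k = 1 - l" by simp
      have "w = f l" unfolding w' k by (simp add: f_def d_def algebra_simps)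
      then show "w \<in> range f" by blast
    next
      assume "w \<in> range f"
      then obtain t where "w = X + t *\<^sub>R (Y - X)" by (auto simp: f_def d_def)
      moreover have "X \<in> span {X, Y}" "Y \<in> span {X, Y}" by (simp_all add: span_base)
      ultimately show "w \<in> span {X, Y}" by (simp add: span_add span_scale span_diff)
    qed
    finally show ?thesis by (simp add: w_def)
  qed
  have img: "coord \<Omega> ` (proj_line x y \<inter> closure \<Omega>) = f ` {p..q}"
  proof
    show "coord \<Omega> ` (proj_line x y \<inter> closure \<Omega>) \<subseteq> f ` {p..q}"
    proof
      fix w assume "w \<in> coord \<Omega> ` (proj_line x y \<inter> closure \<Omega>)"
      then obtain z where z: "z \<in> proj_line x y" "z \<in> closure \<Omega>" "w = coord \<Omega> z" by blast
      then obtain t where "w = f t" using mem_line by blast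
      moreover then have "p \<le> t \<and> t \<le> q" using coord_in_closure_cone[OF z(2)] z(3) chordf by simp
      ultimately show "w \<in> f ` {p..q}" by simp
    qed
    show "f ` {p..q} \<subseteq> coord \<Omega> ` (proj_line x y \<inter> closure \<Omega>)"
    proof
      fix w assume "w \<in> f ` {p..q}"
      then obtain t where t: "w = f t" "p \<le> t" "t \<le> q" by auto
      have "pclass w \<in> closure \<Omega>" using mem_closure_lift_cone[of w] chordf[of t] t af by simp
      moreover have "coord \<Omega> (pclass w) = w" using cf t(1) by simp
      ultimately show "w \<in> coord \<Omega> ` (proj_line x y \<inter> closure \<Omega>)"
        using mem_line[of "pclass w"] t(1) by (intro image_eqI[of _ _ "pclass w"]) auto
    qed
  qed
  have ends: "chord_ends \<Omega> x y r s \<longleftrightarrow> r = P \<and> s = Q" for r s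
  proof
    assume "r = P \<and> s = Q"
    then show "chord_ends \<Omega> x y r s"
      unfolding chord_ends_def img using PQ pq(1,2)
      by (simp add: P_def Q_def cf cseg oseg X[symmetric] Y[symmetric] f01[symmetric] closed_segment_eq_real_ivl
          open_segment_eq_real_ivl)
  next
    assume "chord_ends \<Omega> x y r s"
    then have rs: "r \<in> closure \<Omega>" "s \<in> closure \<Omega>"
      "f ` {p..q} = closed_segment (coord \<Omega> r) (coord \<Omega> s)" "X \<in> open_segment (coord \<Omega> r) Y"
      unfolding chord_ends_def img by (auto simp: ideal_boundary_def X Y)
    have "f ` {p..q} = closed_segment (f p) (f q)" using pq by (simp add: cseg closed_segment_eq_real_ivl)
    then have "{coord \<Omega> r, coord \<Omega> s} = {f p, f q}" using rs(3) by simp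
    \<comment> \<open>A segment determines its endpoints only as an unordered pair; the order
      condition on the chord excludes the exchanged labelling.\<close>
    moreover have "coord \<Omega> r \<noteq> f q"
    proof
      assume "coord \<Omega> r = f q"
      then have "f 0 \<in> f ` open_segment q 1" using rs(4) by (simp add: f01[symmetric] oseg)
      then have "0 \<in> open_segment q 1" using injf by auto
      then show False using pq(2) by (simp add: open_segment_eq_real_ivl)
    qed
    ultimately have "coord \<Omega> r = f p" "coord \<Omega> s = f q" by (auto simp: doubleton_eq_iff)
    then show "r = P \<and> s = Q" using pclass_coord[OF rs(1)] pclass_coord[OF rs(2)] by (simp add: P_def Q_def)
  qed
  have "(THE (r, s). chord_ends \<Omega> x y r s) = (P, Q)"
    by (rule the_equality) (auto simp: ends)
  then have "hilbert_dist \<Omega> x y = 1/2 * ln ((norm (f 1 - f p) * norm (f 0 - f q)) / (norm (f 0 - f p) * norm (f 1 - f q)))"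
    unfolding hilbert_dist_def using xy(3) by (simp add: X[symmetric] Y[symmetric] f01 P_def Q_def cf)
  moreover have "norm (f s - f t) = \<bar>s - t\<bar> * norm d" for s t
  proof -
    have "f s - f t = (s - t) *\<^sub>R d" by (simp add: f_def algebra_simps)
    then show ?thesis by simp
  qed
  ultimately show ?thesis using d pq(1,2) by (simp add: mult_ac)
qed

text \<open>Both sides bound the same cross-ratio of the chord. From here on, distances are handled
  through the linear description only.\<close>

lemma hilbert_dist_le_iff:
  assumes "x \<in> \<Omega>" "y \<in> \<Omega>"
  shows "hilbert_dist \<Omega> x y \<le> D \<longleftrightarrow> birkhoff D (coord \<Omega> x) (coord \<Omega> y)"
proof (cases "x = y")
  case True
  have "0 \<le> D" if "birkhoff D (coord \<Omega> y) (coord \<Omega> y)"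
    using birkhoff_nonneg[OF that] inner_coord domain_subset_closure[OF assms(2)] by blast
  then show ?thesis using birkhoff_refl[of D] True by (auto simp: hilbert_dist_def)
next
  case False
  define X where "X = coord \<Omega> x"
  define Y where "Y = coord \<Omega> y"
  have cl: "x \<in> closure \<Omega>" "y \<in> closure \<Omega>" using assms domain_subset_closure by auto
  have XY: "X \<in> cone" "a \<bullet> X = 1" "Y \<in> cone" "a \<bullet> Y = 1"
    using coord_in_cone cl assms inner_coord by (auto simp: X_def Y_def)
  have "X \<noteq> Y" using False inj_onD[OF inj_on_coord _ cl] by (auto simp: X_def Y_def)
  obtain p q where pq: "p < 0" "1 < q" "X + p *\<^sub>R (Y - X) \<notin> cone" "X + q *\<^sub>R (Y - X) \<notin> cone"
    "\<And>t. X + t *\<^sub>R (Y - X) \<in> closure cone \<longleftrightarrow> p \<le> t \<and> t \<le> q"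
    using chord_interval[OF XY \<open>X \<noteq> Y\<close>] by blast
  define R where "R = ((1 - p) * q) / ((- p) * (q - 1))"
  have R: "0 < R" unfolding R_def using pq(1,2) by (intro divide_pos_pos mult_pos_pos) auto
  have "hilbert_dist \<Omega> x y \<le> D \<longleftrightarrow> ln R \<le> 2 * D"
    using hilbert_dist_chord[OF assms False X_def Y_def pq] unfolding R_def[symmetric] by auto
  also have "\<dots> \<longleftrightarrow> R \<le> exp (2 * D)" using R by (metis exp_le_cancel_iff exp_ln)
  also have "\<dots> \<longleftrightarrow> birkhoff D X Y" using birkhoff_chord[OF XY \<open>X \<noteq> Y\<close> pq(1,2,5), of D] by (simp add: R_def)
  finally show ?thesis by (simp add: X_def Y_def)
qed

section \<open>Simplices in the domain\<close>

lemma pclass_in_domain: "T \<in> cone \<Longrightarrow> pclass T \<in> \<Omega>"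
  by (simp add: lift_cone_def)

lemma coord_pclass_cone: "T \<in> cone \<Longrightarrow> coord \<Omega> (pclass T) = T /\<^sub>R (a \<bullet> T)"
  using height_pos[of T] by (simp add: coord_eq chart_coord_pclass)

text \<open>The infimum of reals is meaningful only for nonempty sets bounded below; the lower bound
  0 comes from \<open>birkhoff_nonneg\<close>.\<close>

lemma hilbert_nbhd_iff:
  assumes "x \<in> \<Omega>" "C \<subseteq> \<Omega>" "C \<noteq> {}"
  shows "x \<in> hilbert_nbhd \<Omega> \<delta> C \<longleftrightarrow> (\<exists>c\<in>C. hilbert_dist \<Omega> x c < \<delta>)"
proof -
  have "0 \<le> hilbert_dist \<Omega> x c" if "c \<in> C" for c
    using hilbert_dist_le_iff[OF assms(1), of c "hilbert_dist \<Omega> x c"] that assms(1,2)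
      birkhoff_nonneg inner_coord domain_subset_closure by (meson order_refl subsetD)
  then have "bdd_below (hilbert_dist \<Omega> x ` C)" by (rule bdd_belowI2)
  then show ?thesis using assms by (simp add: hilbert_nbhd_def cINF_less_iff)
qed

lemma CH_subset_domain: assumes "X \<subseteq> \<Omega>" shows "CH \<Omega> X \<subseteq> \<Omega>"
  unfolding CH_def using assms adapted domain_subset_closure
  by (intro Inter_lower CollectI conjI) (auto simp: adapted_chart_def coord_eq)

lemma compact_simplex_facet:
  assumes "compact_simplex \<Omega> k v" "i \<le> k"
  shows "facet \<Omega> k v i \<subseteq> \<Omega>" and "facet \<Omega> k v i \<noteq> {}"
proof -
  have v: "k \<ge> 1" "v ` {..k} \<subseteq> \<Omega>" using assms by (auto simp: compact_simplex_def is_simplex_def)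
  have "v ` ({..k} - {i}) \<subseteq> \<Omega>" using v(2) by blast
  then show "facet \<Omega> k v i \<subseteq> \<Omega>" unfolding facet_def by (rule CH_subset_domain)
  have "(if i = 0 then 1 else 0) \<in> {..k} - {i}" using v(1) by auto
  then have "v (if i = 0 then 1 else 0) \<in> v ` ({..k} - {i})" by (rule imageI)
  then show "facet \<Omega> k v i \<noteq> {}" unfolding facet_def CH_def by blast
qed

lemma slim_iff:
  assumes "compact_simplex \<Omega> k v"
  shows "slim \<Omega> \<delta> k v \<longleftrightarrow> (\<forall>i\<le>k. \<forall>x\<in>facet \<Omega> k v i. \<exists>j\<in>{..k} - {i}. \<exists>c\<in>facet \<Omega> k v j. hilbert_dist \<Omega> x c < \<delta>)"
proof -
  have "x \<in> hilbert_nbhd \<Omega> \<delta> (facet \<Omega> k v j) \<longleftrightarrow> (\<exists>c\<in>facet \<Omega> k v j. hilbert_dist \<Omega> x c < \<delta>)"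
    if "i \<le> k" "x \<in> facet \<Omega> k v i" "j \<le> k" for i j x
    using compact_simplex_facet[OF assms] that by (intro hilbert_nbhd_iff) blast+
  then show ?thesis unfolding slim_def subset_iff UN_iff Ball_def by (metis Diff_iff atMost_iff)
qed

lemma pclass_in_CH:
  assumes "finite I" "v ` I \<subseteq> closure \<Omega>" "T \<in> cone" "T \<in> conic_hull (\<lambda>l. coord \<Omega> (v l)) I"
  shows "pclass T \<in> CH \<Omega> (v ` I)"
proof -
  have "pclass T \<in> closure \<Omega>" using pclass_in_domain[OF assms(3)] by (rule domain_subset_closure)
  moreover have "coord \<Omega> (pclass T) \<in> conic_hull (\<lambda>l. coord \<Omega> (v l)) I"
    unfolding coord_pclass_cone[OF assms(3)]
    using assms(4) height_pos[OF assms(3)] by (intro conic_hull_scale) auto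
  ultimately show ?thesis using mem_CH_iff[OF assms(1,2)] by blast
qed

lemma pclass_in_facet:
  assumes "v ` {..k} \<subseteq> closure \<Omega>" "T \<in> cone" "T \<in> conic_hull (\<lambda>l. coord \<Omega> (v l)) ({..k} - {i})"
  shows "pclass T \<in> facet \<Omega> k v i"
  unfolding facet_def using assms by (intro pclass_in_CH) auto

lemma mem_facet_iff:
  assumes "v ` {..k} \<subseteq> closure \<Omega>"
  shows "p \<in> facet \<Omega> k v i \<longleftrightarrow>
    p \<in> closure \<Omega> \<and> coord \<Omega> p \<in> conic_hull (\<lambda>l. coord \<Omega> (v l)) ({..k} - {i})"
  unfolding facet_def using assms by (intro mem_CH_iff) auto

section \<open>Boundary simplices, PES and slimness\<close>

text \<open>Facets missing the cone lie in the ideal boundary, and so do the vertices, each of which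
  lies on some facet because \<open>1 \<le> k\<close>. Nondegeneracy follows from
  \<open>facet_avoiding_independent\<close>.\<close>

lemma PES_of_boundary_simplex:
  assumes k: "1 \<le> k"
    and W: "\<And>l. l \<in> {..k} \<Longrightarrow> W l \<in> closure cone" "\<And>l. l \<in> {..k} \<Longrightarrow> a \<bullet> W l = 1"
    and Z: "Z \<in> cone" "Z \<in> conic_hull W {..k}"
    and avoid: "\<And>j. j \<in> {..k} \<Longrightarrow> conic_hull W ({..k} - {j}) \<inter> cone = {}"
  shows "PES \<Omega> k (\<lambda>l. pclass (W l))"
proof -
  let ?v = "\<lambda>l. pclass (W l)"
  have cl: "?v ` {..k} \<subseteq> closure \<Omega>"
    using W mem_closure_lift_cone by fastforce
  have cv: "coord \<Omega> (?v l) = W l" if "l \<in> {..k}" for l using coord_pclass W(2)[OF that] .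
  have hull: "conic_hull (\<lambda>l. coord \<Omega> (?v l)) I = conic_hull W I" if "I \<subseteq> {..k}" for I
    using cv that by (intro conic_hull_cong) blast
  have facets: "facet \<Omega> k ?v i \<subseteq> ideal_boundary \<Omega>" if "i \<le> k" for i
  proof
    fix p assume "p \<in> facet \<Omega> k ?v i"
    then have p: "p \<in> closure \<Omega>" "coord \<Omega> p \<in> conic_hull W ({..k} - {i})"
      using mem_facet_iff[OF cl] hull by auto
    then have "coord \<Omega> p \<notin> cone" using avoid[of i] that by blast
    then show "p \<in> ideal_boundary \<Omega>" using p(1) coord_in_cone by (auto simp: ideal_boundary_def)
  qed
  have vertices: "?v ` {..k} \<subseteq> ideal_boundary \<Omega>"
  proof
    fix p assume "p \<in> ?v ` {..k}"
    then obtain l where l: "l \<in> {..k}" "p = ?v l" by blast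
    define j where "j = (if l = 0 then 1 else 0 :: nat)"
    have j: "j \<le> k" "l \<in> {..k} - {j}" using l(1) k by (auto simp: j_def)
    have "p \<in> facet \<Omega> k ?v j" using l(2) j(2) by (auto simp: facet_def CH_def)
    then show "p \<in> ideal_boundary \<Omega>" using facets[OF j(1)] by blast
  qed
  have "pclass Z \<in> CH \<Omega> (?v ` {..k})" using pclass_in_CH[OF _ cl Z(1)] Z(2) hull by simp
  then have meets: "simplex_hull \<Omega> k ?v \<inter> \<Omega> \<noteq> {}"
    using pclass_in_domain[OF Z(1)] by (auto simp: simplex_hull_def)
  have ind: "inj_on W {..k}" "independent (W ` {..k})"
    using independent_family[of "{..k}" W] facet_avoiding_independent[OF _ Z avoid] by auto
  have "span (\<Union>i\<le>k. line_of (?v i)) = span (W ` {..k})"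
  proof (rule subset_antisym)
    have lines: "line_of (?v i) = span {W i}" if "i \<in> {..k}" for i
      using W(2)[OF that] by (intro line_of_pclass) auto
    have "(\<Union>i\<le>k. line_of (?v i)) \<subseteq> span (W ` {..k})"
    proof (rule UN_least)
      show "line_of (?v i) \<subseteq> span (W ` {..k})" if "i \<in> {..k}" for i
        unfolding lines[OF that] using that by (intro span_mono) auto
    qed
    then show "span (\<Union>i\<le>k. line_of (?v i)) \<subseteq> span (W ` {..k})"
      by (rule span_minimal) (rule subspace_span)
    have "W ` {..k} \<subseteq> (\<Union>i\<le>k. line_of (?v i))"
    proof
      fix w assume "w \<in> W ` {..k}"
      then obtain i where i: "i \<in> {..k}" "w = W i" by blast
      then have "w \<in> line_of (?v i)" using lines[OF i(1)] span_base[of w "{w}"] by simp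
      then show "w \<in> (\<Union>i\<le>k. line_of (?v i))" using i(1) by blast
    qed
    then show "span (W ` {..k}) \<subseteq> span (\<Union>i\<le>k. line_of (?v i))" by (rule span_mono)
  qed
  then have "dim (span (\<Union>i\<le>k. line_of (?v i))) = k + 1"
    using dim_eq_card_independent[OF ind(2)] card_image[OF ind(1)] by simp
  then have "nondegenerate k ?v" by (simp add: nondegenerate_def)
  then show ?thesis using k cl facets vertices meets by (auto simp: PES_def is_simplex_def)
qed

text \<open>The corner at vertex 0 is cut with \<open>\<delta>\<close> as the distance to beat. The
  point \<open>Y\<close> of facet 0 is then too far from all other facets.\<close>

lemma not_slim_of_PES:
  assumes "PES \<Omega> k v"
  obtains u where "compact_simplex \<Omega> k u" "\<not> slim \<Omega> \<delta> k u"
proof -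
  have v: "k \<ge> 1" "v ` {..k} \<subseteq> closure \<Omega>" "simplex_hull \<Omega> k v \<inter> \<Omega> \<noteq> {}"
    "\<And>i. i \<le> k \<Longrightarrow> facet \<Omega> k v i \<subseteq> ideal_boundary \<Omega>"
    using assms by (auto simp: PES_def is_simplex_def)
  define W where "W l = coord \<Omega> (v l)" for l
  have W: "W l \<in> closure cone" "a \<bullet> W l = 1" if "l \<in> {..k}" for l
    using v(2) that coord_in_closure_cone inner_coord by (auto simp: W_def)
  obtain z where z: "z \<in> simplex_hull \<Omega> k v" "z \<in> \<Omega>" using v(3) by blast
  have Z: "coord \<Omega> z \<in> cone" "coord \<Omega> z \<in> conic_hull W {..k}"
    using z coord_in_cone domain_subset_closure mem_CH_iff[OF _ v(2)]
    by (auto simp: simplex_hull_def W_def[abs_def])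
  have avoid: "conic_hull W ({..k} - {j}) \<inter> cone = {}" if "j \<in> {..k}" for j
  proof (rule ccontr)
    assume "conic_hull W ({..k} - {j}) \<inter> cone \<noteq> {}"
    then obtain X where X: "X \<in> conic_hull W ({..k} - {j})" "X \<in> cone" by blast
    have "pclass X \<in> facet \<Omega> k v j" using pclass_in_facet[OF v(2) X(2)] X(1) by (simp add: W_def[abs_def])
    then show False using v(4)[of j] pclass_in_domain[OF X(2)] that by (auto simp: ideal_boundary_def)
  qed
  have k0: "0 \<in> {..k}" "{..k} \<noteq> {0}" using v(1) by auto
  obtain U Y where U: "\<And>l. l \<in> {..k} \<Longrightarrow> U l \<in> cone" "\<And>l. l \<in> {..k} \<Longrightarrow> a \<bullet> U l = 1"
    and Y: "Y \<in> cone" "Y \<in> conic_hull U ({..k} - {0})"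
    and far: "\<And>j T. j \<in> {..k} - {0} \<Longrightarrow> T \<in> conic_hull U ({..k} - {j}) \<Longrightarrow> T \<in> cone \<Longrightarrow> \<not> birkhoff \<delta> Y T"
    by (rule fat_simplex_of_boundary_simplex[of "{..k}" 0 W "coord \<Omega> z" \<delta>, OF _ k0 W Z avoid]) auto
  let ?u = "\<lambda>l. pclass (U l)"
  have u: "?u ` {..k} \<subseteq> \<Omega>" using U(1) by (auto simp: lift_cone_def)
  then have cl: "?u ` {..k} \<subseteq> closure \<Omega>" using domain_subset_closure by blast
  have cu: "coord \<Omega> (?u l) = U l" if "l \<in> {..k}" for l using coord_pclass U(2)[OF that] .
  have hull: "conic_hull (\<lambda>l. coord \<Omega> (?u l)) I = conic_hull U I" if "I \<subseteq> {..k}" for I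
    using cu that by (intro conic_hull_cong) blast
  have comp: "compact_simplex \<Omega> k ?u" using u cl v(1) by (simp add: compact_simplex_def is_simplex_def)
  have "\<not> slim \<Omega> \<delta> k ?u"
  proof
    assume "slim \<Omega> \<delta> k ?u"
    have x: "pclass Y \<in> \<Omega>" by (rule pclass_in_domain[OF Y(1)])
    have "pclass Y \<in> facet \<Omega> k ?u 0" using pclass_in_facet[OF cl Y(1)] Y(2) hull by simp
    then obtain j c where j: "j \<in> {..k} - {0}" and c: "c \<in> facet \<Omega> k ?u j" "hilbert_dist \<Omega> (pclass Y) c < \<delta>"
      using \<open>slim \<Omega> \<delta> k ?u\<close> slim_iff[OF comp] by blast
    have c': "c \<in> \<Omega>" using c(1) compact_simplex_facet(1)[OF comp] j by blast
    then have T: "coord \<Omega> c \<in> cone" using coord_in_cone domain_subset_closure by simp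
    have "coord \<Omega> c \<in> conic_hull U ({..k} - {j})" using c(1) mem_facet_iff[OF cl] hull by simp
    then have "\<not> birkhoff \<delta> Y (coord \<Omega> c)" using far j T by blast
    moreover have "birkhoff \<delta> (Y /\<^sub>R (a \<bullet> Y)) (coord \<Omega> c)"
      using hilbert_dist_le_iff[OF x c', of \<delta>] c(2) by (simp add: coord_pclass_cone[OF Y(1)])
    ultimately show False
      using birkhoff_scale[of \<delta> "Y /\<^sub>R (a \<bullet> Y)" "coord \<Omega> c" "a \<bullet> Y" 1] height_pos[OF Y(1)] by simp
  qed
  then show ?thesis using that comp by blast
qed

text \<open>Without a bound there are ever fatter simplices, and their limits give a PES. Fixing
  \<open>i\<close> beforehand ensures that the bad facet has the same index along the whole
  sequence.\<close>

lemma uniformly_slim_facet: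
  assumes qh: "quasi_homogeneous \<Omega>" and k: "1 \<le> k" and i: "i \<le> k" and no_PES: "\<And>v. \<not> PES \<Omega> k v"
  obtains N :: nat where "\<And>v x. compact_simplex \<Omega> k v \<Longrightarrow> x \<in> facet \<Omega> k v i \<Longrightarrow>
    \<exists>j\<in>{..k} - {i}. \<exists>c\<in>facet \<Omega> k v j. hilbert_dist \<Omega> x c < real N"
proof (rule ccontr)
  assume "\<not> thesis"
  then have "\<exists>v x. compact_simplex \<Omega> k v \<and> x \<in> facet \<Omega> k v i \<and>
      \<not> (\<exists>j\<in>{..k} - {i}. \<exists>c\<in>facet \<Omega> k v j. hilbert_dist \<Omega> x c < real (Suc n))" for n
    using that by blast
  then obtain v x where v: "\<And>n. compact_simplex \<Omega> k (v n)" and x: "\<And>n. x n \<in> facet \<Omega> k (v n) i"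
    and dist: "\<And>n j c. j \<in> {..k} - {i} \<Longrightarrow> c \<in> facet \<Omega> k (v n) j \<Longrightarrow> \<not> hilbert_dist \<Omega> (x n) c < real (Suc n)"
    by metis
  define V where "V n l = coord \<Omega> (v n l)" for n l
  define X where "X n = coord \<Omega> (x n)" for n
  have vcl: "v n ` {..k} \<subseteq> closure \<Omega>" for n
    using v[of n] by (auto simp: compact_simplex_def is_simplex_def)
  have xD: "x n \<in> \<Omega>" for n using x compact_simplex_facet(1)[OF v i] by blast
  have V: "V n l \<in> closure cone" "V n l \<noteq> 0" if "l \<in> {..k}" for n l
  proof -
    have "v n l \<in> closure \<Omega>" using vcl that by blast
    then show "V n l \<in> closure cone" "V n l \<noteq> 0"
      using coord_in_closure_cone inner_coord[of "v n l"] by (auto simp: V_def)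
  qed
  have X: "X n \<in> cone" "X n \<in> conic_hull (V n) ({..k} - {i})" for n
    using xD[of n] x[of n] mem_facet_iff[OF vcl] coord_in_cone domain_subset_closure
    by (auto simp: X_def V_def[abs_def])
  have far: "\<not> birkhoff (real n) (X n) T"
    if j: "j \<in> {..k} - {i}" and T: "T \<in> conic_hull (V n) ({..k} - {j})" "T \<in> cone" for n j T
  proof
    assume b: "birkhoff (real n) (X n) T"
    have "pclass T \<in> facet \<Omega> k (v n) j"
      using pclass_in_facet[OF vcl T(2)] T(1) by (simp add: V_def[abs_def])
    then have "\<not> hilbert_dist \<Omega> (x n) (pclass T) \<le> real n" using dist[OF j, of "pclass T" n] by simp
    moreover have "birkhoff (real n) (X n) (T /\<^sub>R (a \<bullet> T))"
      using birkhoff_scale[OF b, of 1 "inverse (a \<bullet> T)"] height_pos[OF T(2)] by simp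
    ultimately show False
      using hilbert_dist_le_iff[OF xD pclass_in_domain[OF T(2)], of n "real n"]
      by (simp add: coord_pclass_cone[OF T(2)] X_def)
  qed
  obtain K0 where K0: "compact K0" "K0 \<subseteq> cone"
    "\<And>X. X \<in> cone \<Longrightarrow> \<exists>A. linear A \<and> inj A \<and> A ` cone = cone \<and> A X \<in> K0"
    using cocompact_cone[OF qh] by blast
  have fin: "finite {..k}" and ik: "i \<in> {..k}" using i by auto
  obtain W Z where W: "\<And>l. l \<in> {..k} \<Longrightarrow> W l \<in> closure cone" "\<And>l. l \<in> {..k} \<Longrightarrow> a \<bullet> W l = 1"
    and Z: "Z \<in> cone" "Z \<in> conic_hull W {..k}"
    and avoid: "\<And>j. j \<in> {..k} \<Longrightarrow> conic_hull W ({..k} - {j}) \<inter> cone = {}"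
    by (rule boundary_simplex_of_fat_simplices[OF K0 fin ik V X far]) blast+
  show False using PES_of_boundary_simplex[OF k W Z avoid] no_PES by blast
qed

text \<open>There are \<open>k + 1\<close> lifted vertices, more than the dimension of the vector
  space, so a relation exists and the exchange applies.\<close>

lemma degenerate_slim:
  assumes "compact_simplex \<Omega> k v" "CARD('d) \<le> k" "i \<le> k" "x \<in> facet \<Omega> k v i"
  obtains j where "j \<in> {..k} - {i}" "x \<in> facet \<Omega> k v j"
proof -
  have vcl: "v ` {..k} \<subseteq> closure \<Omega>" using assms(1) by (simp add: compact_simplex_def is_simplex_def)
  let ?V = "\<lambda>l. coord \<Omega> (v l)"
  have x: "x \<in> closure \<Omega>" "coord \<Omega> x \<in> conic_hull ?V ({..k} - {i})"
    using assms(4) mem_facet_iff[OF vcl] by auto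
  have pos: "0 < a \<bullet> ?V l" if "l \<in> {..k}" for l using vcl that inner_coord by auto
  obtain c m where c: "(\<Sum>l\<in>{..k}. c l *\<^sub>R ?V l) = 0" "m \<in> {..k}" "c m \<noteq> 0"
    using dependent_family[of "{..k}" ?V] assms(2) by auto
  obtain j where "j \<in> {..k}" "j \<noteq> i" "coord \<Omega> x \<in> conic_hull ?V ({..k} - {j})"
    by (rule dependent_facet_swap[OF _ x(2) pos c]) auto
  then show ?thesis using that x(1) mem_facet_iff[OF vcl] by blast
qed

lemma uniformly_slim:
  assumes qh: "quasi_homogeneous \<Omega>" and no_PES: "\<And>k v. m < k \<Longrightarrow> \<not> PES \<Omega> k v"
  obtains \<delta> where "0 < \<delta>" "\<And>k v. m < k \<Longrightarrow> compact_simplex \<Omega> k v \<Longrightarrow> slim \<Omega> \<delta> k v"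
proof -
  have "\<exists>N. \<forall>v x. m < k \<longrightarrow> i \<le> k \<longrightarrow> compact_simplex \<Omega> k v \<longrightarrow> x \<in> facet \<Omega> k v i \<longrightarrow>
      (\<exists>j\<in>{..k} - {i}. \<exists>c\<in>facet \<Omega> k v j. hilbert_dist \<Omega> x c < real N)" for k i
  proof (cases "m < k \<and> i \<le> k")
    case True
    then have "1 \<le> k" "i \<le> k" "\<And>v. \<not> PES \<Omega> k v" using no_PES by auto
    then show ?thesis using uniformly_slim_facet[OF qh, of k i] by metis
  qed auto
  then obtain N where N: "\<And>k i v x. m < k \<Longrightarrow> i \<le> k \<Longrightarrow> compact_simplex \<Omega> k v \<Longrightarrow> x \<in> facet \<Omega> k v i \<Longrightarrow>
      \<exists>j\<in>{..k} - {i}. \<exists>c\<in>facet \<Omega> k v j. hilbert_dist \<Omega> x c < real (N k i)" by metis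
  \<comment> \<open>Only dimensions below \<open>CARD('d)\<close> contribute, so the sum is finite.
    The summand 1 keeps it positive, which suffices in higher dimensions, where the distance to
    another facet is 0.\<close>
  define \<delta> where "\<delta> = 1 + (\<Sum>k<CARD('d). \<Sum>i\<le>k. real (N k i))"
  have pos: "0 < \<delta>" unfolding \<delta>_def by (intro add_pos_nonneg sum_nonneg) auto
  have le: "real (N k i) \<le> \<delta>" if "k < CARD('d)" "i \<le> k" for k i
  proof -
    have "real (N k i) \<le> (\<Sum>i\<le>k. real (N k i))" using that by (intro member_le_sum) auto
    also have "\<dots> \<le> (\<Sum>k<CARD('d). \<Sum>i\<le>k. real (N k i))"
      using that by (intro member_le_sum[of k _ "\<lambda>k. \<Sum>i\<le>k. real (N k i)"]) (auto intro: sum_nonneg)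
    finally show ?thesis by (simp add: \<delta>_def)
  qed
  have "slim \<Omega> \<delta> k v" if k: "m < k" and v: "compact_simplex \<Omega> k v" for k v
    unfolding slim_iff[OF v]
  proof (intro allI impI ballI)
    fix i x assume ix: "i \<le> k" "x \<in> facet \<Omega> k v i"
    show "\<exists>j\<in>{..k} - {i}. \<exists>c\<in>facet \<Omega> k v j. hilbert_dist \<Omega> x c < \<delta>"
    proof (cases "k < CARD('d)")
      case True
      then show ?thesis using N[OF k ix(1) v ix(2)] le[OF True ix(1)] by (blast intro: less_le_trans)
    next
      case False
      then have "CARD('d) \<le> k" by simp
      then obtain j where "j \<in> {..k} - {i}" "x \<in> facet \<Omega> k v j"
        using degenerate_slim[OF v _ ix] by blast
      moreover have "hilbert_dist \<Omega> x x < \<delta>" using pos by (simp add: hilbert_dist_def)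
      ultimately show ?thesis by blast
    qed
  qed
  then show ?thesis using that pos by blast
qed

end

theorem proposition4p3:
  fixes \<Omega> :: "'d::finite rproj set" and m :: nat
  assumes "properly_convex_domain \<Omega>"
    and "quasi_homogeneous \<Omega>"
    and "1 \<le> m" and "m \<le> CARD('d) - 1"
  shows "PES_rank \<Omega> \<le> enat m \<longleftrightarrow>
    (\<exists>\<delta>::real. \<delta> > 0 \<and>
      (\<forall>k\<ge>m + 1. \<forall>v. compact_simplex \<Omega> k v \<longrightarrow> slim \<Omega> \<delta> k v))"
proof -
  \<comment> \<open>The same choice as in \<open>coord\<close>, so that the locale's chart is the
    one in which distances and hulls are computed.\<close>
  define a where "a = (SOME a. adapted_chart \<Omega> a)"
  interpret charted_domain \<Omega> a
  proof
    show "open \<Omega>" "\<Omega> \<noteq> {}" using assms(1) by (simp_all add: properly_convex_domain_def)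
    have "\<exists>a. adapted_chart \<Omega> a" using assms(1) by (simp add: properly_convex_domain_def)
    then show "adapted_chart \<Omega> a" unfolding a_def by (rule someI_ex)
    show "coord \<Omega> = chart_coord a" unfolding coord_def a_def ..
  qed
  have "{enat k | k v. PES \<Omega> k v} = enat ` {k. \<exists>v. PES \<Omega> k v}" by auto
  then have "PES_rank \<Omega> \<le> enat m \<longleftrightarrow> (\<forall>k v. PES \<Omega> k v \<longrightarrow> k \<le> m)"
    by (auto simp: PES_rank_def Sup_le_iff)
  also have "\<dots> \<longleftrightarrow> (\<exists>\<delta>::real. \<delta> > 0 \<and>
      (\<forall>k\<ge>m + 1. \<forall>v. compact_simplex \<Omega> k v \<longrightarrow> slim \<Omega> \<delta> k v))"
  proof
    assume "\<forall>k v. PES \<Omega> k v \<longrightarrow> k \<le> m"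
    then have "\<not> PES \<Omega> k v" if "m < k" for k v using that by (meson not_less)
    then obtain \<delta> where "0 < \<delta>" "\<And>k v. m < k \<Longrightarrow> compact_simplex \<Omega> k v \<Longrightarrow> slim \<Omega> \<delta> k v"
      using uniformly_slim[OF assms(2)] by metis
    then show "\<exists>\<delta>::real. \<delta> > 0 \<and> (\<forall>k\<ge>m + 1. \<forall>v. compact_simplex \<Omega> k v \<longrightarrow> slim \<Omega> \<delta> k v)"
      by (intro exI[of _ \<delta>]) auto
  next
    assume "\<exists>\<delta>::real. \<delta> > 0 \<and> (\<forall>k\<ge>m + 1. \<forall>v. compact_simplex \<Omega> k v \<longrightarrow> slim \<Omega> \<delta> k v)"
    then obtain \<delta> :: real where slim: "\<And>k v. m + 1 \<le> k \<Longrightarrow> compact_simplex \<Omega> k v \<Longrightarrow> slim \<Omega> \<delta> k v"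
      by blast
    show "\<forall>k v. PES \<Omega> k v \<longrightarrow> k \<le> m"
    proof (intro allI impI, rule ccontr)
      fix k v assume "PES \<Omega> k v" "\<not> k \<le> m"
      then have "m + 1 \<le> k" by simp
      then show False using not_slim_of_PES[OF \<open>PES \<Omega> k v\<close>, of \<delta>] slim[of k] by blast
    qed
  qed
  finally show ?thesis .
qed

end
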